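(* For strict partitions $\mu,\lambda$, the power series $jp^{\mathrm{comb}}_{\lambda/\mu}$ and $jq^{\mathrm{comb}}_{\lambda/\mu}$ are symmetric in the variables $x_1,x_2,\dots$.
   Context: For strict partitions $\mu\subseteq\lambda$, $\mathsf{SD}_{\lambda/\mu}=\mathsf{SD}_\lambda\setminus\mathsf{SD}_\mu$ where $\mathsf{SD}_\lambda=\{(i,i+j-1):1\le i\le\ell(\lambda),1\le j\le\lambda_i\}$; $(i,i)$ are diagonal boxes; $|\lambda/\mu|=|\lambda|-|\mu|$. Primed numbers $i'=i-\tfrac12$, ordered $1'<1<2'<2<\dots$; $\beta,x_1,x_2,\dots$ commuting indeterminates. A shifted bar tableau of shape $\lambda/\mu$ is a pair $T=(V,\Pi)$ where $V$ fills each box of $\mathsf{SD}_{\lambda/\mu}$ with one element of $\{1'<1<2'<\dots\}$, with no unprimed entry repeated in a column and no primed entry repeated in a row, and $\Pi$ partitions $\mathsf{SD}_{\lambda/\mu}$ into nonempty blocks ("bars") of contiguous boxes in one row or one column all with the same entry. It is semistandard if $V$ weakly increases along rows and columns. $|T|$ is the number of bars; ${\bf x}^T=\prod_ix_i^{b_i}$ with $b_i$ the number of bars containing $i$ or $i'$. $\mathsf{ShBT}_Q(\lambda/\mu)$ denotes the semistandard shifted bar tableaux of shape $\lambda/\mu$ and $\mathsf{ShBT}_P(\lambda/\mu)$ those with no primed diagonal entries (both empty if $\mu\not\subseteq\lambda$). Define $jp^{\mathrm{comb}}_{\lambda/\mu}=\sum_{T\in\mathsf{ShBT}_P(\lambda/\mu)}(-\beta)^{|\lambda/\mu|-|T|}{\bf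 x}^T$ and $jq^{\mathrm{comb}}_{\lambda/\mu}=\sum_{T\in\mathsf{ShBT}_Q(\lambda/\mu)}(-\beta)^{|\lambda/\mu|-|T|}{\bf x}^T$. *)

theory Defs
  imports
    "HOL-Library.FuncSet"
    "HOL-Library.Disjoint_Sets"
    "HOL-Library.Poly_Mapping"
    "HOL-Computational_Algebra.Polynomial"
    "HOL-Combinatorics.Permutations"
begin

definition strict_partition :: "nat list \<Rightarrow> bool" where
  "strict_partition lam \<longleftrightarrow> sorted_wrt (>) lam \<and> (\<forall>p\<in>set lam. 0 < p)"

definition part_contained :: "nat list \<Rightarrow> nat list \<Rightarrow> bool" where
  "part_contained mu lam \<longleftrightarrow>
     length mu \<le> length lam \<and> (\<forall>i<length mu. mu ! i \<le> lam ! i)"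

definition SD :: "nat list \<Rightarrow> (nat \<times> nat) set" where
  "SD lam = {(i, i + j - 1) |i j. 1 \<le> i \<and> i \<le> length lam \<and> 1 \<le> j \<and> j \<le> lam ! (i - 1)}"

definition skew_SD :: "nat list \<Rightarrow> nat list \<Rightarrow> (nat \<times> nat) set" where
  "skew_SD lam mu = SD lam - SD mu"

definition skew_size :: "nat list \<Rightarrow> nat list \<Rightarrow> nat" where
  "skew_size lam mu = sum_list lam - sum_list mu"

text \<open>
  The alphabet \<open>1' < 1 < 2' < 2 < \<dots>\<close>, where \<open>i' = i - 1/2\<close>, is represented by the positive
  natural numbers through doubling: \<open>i'\<close> becomes \<open>2 * i - 1\<close> and \<open>i\<close> becomes \<open>2 * i\<close>.
\<close>

definition primed :: "nat \<Rightarrow> nat" where "primed i = 2 * i - 1"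

definition unprimed :: "nat \<Rightarrow> nat" where "unprimed i = 2 * i"

definition entries :: "nat set" where
  "entries = primed ` {1..} \<union> unprimed ` {1..}"

definition is_primed :: "nat \<Rightarrow> bool" where
  "is_primed e \<longleftrightarrow> e \<in> primed ` {1..}"

definition is_unprimed :: "nat \<Rightarrow> bool" where
  "is_unprimed e \<longleftrightarrow> e \<in> unprimed ` {1..}"

text \<open>Row index first: \<open>(i, j)\<close> lies in row \<open>i\<close> and column \<open>j\<close>.\<close>

definition contiguous_line :: "(nat \<times> nat) set \<Rightarrow> bool" where
  "contiguous_line B \<longleftrightarrow> (\<exists>i a b. B = {i} \<times> {a..b}) \<or> (\<exists>j a b. B = {a..b} \<times> {j})"

type_synonym bar_tableau = "((nat \<times> nat) \<Rightarrow> nat) \<times> (nat \<times> nat) set set"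

text \<open>
  Fillings are extensional functions on the shape, so that distinct pairs are distinct tableaux.
\<close>

definition shifted_bar_tableaux :: "(nat \<times> nat) set \<Rightarrow> bar_tableau set" where
  "shifted_bar_tableaux D = {(V, P).
     V \<in> D \<rightarrow>\<^sub>E entries \<and>
     (\<forall>i k j. (i, j) \<in> D \<longrightarrow> (k, j) \<in> D \<longrightarrow> i \<noteq> k \<longrightarrow> is_unprimed (V (i, j)) \<longrightarrow>
        V (i, j) \<noteq> V (k, j)) \<and>
     (\<forall>i j k. (i, j) \<in> D \<longrightarrow> (i, k) \<in> D \<longrightarrow> j \<noteq> k \<longrightarrow> is_primed (V (i, j)) \<longrightarrow>
        V (i, j) \<noteq> V (i, k)) \<and>
     partition_on D P \<and>
     (\<forall>B\<in>P. contiguous_line B \<and> (\<forall>b\<in>B. \<forall>c\<in>B. V b = V c))}"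

definition semistandard :: "(nat \<times> nat) set \<Rightarrow> bar_tableau \<Rightarrow> bool" where
  "semistandard D T \<longleftrightarrow>
     (\<forall>i j k. (i, j) \<in> D \<longrightarrow> (i, k) \<in> D \<longrightarrow> j \<le> k \<longrightarrow> fst T (i, j) \<le> fst T (i, k)) \<and>
     (\<forall>i k j. (i, j) \<in> D \<longrightarrow> (k, j) \<in> D \<longrightarrow> i \<le> k \<longrightarrow> fst T (i, j) \<le> fst T (k, j))"

definition ShBT_Q :: "nat list \<Rightarrow> nat list \<Rightarrow> bar_tableau set" where
  "ShBT_Q lam mu =
     (if part_contained mu lam
      then {T \<in> shifted_bar_tableaux (skew_SD lam mu). semistandard (skew_SD lam mu) T}
      else {})"

definition ShBT_P :: "nat list \<Rightarrow> nat list \<Rightarrow> bar_tableau set" where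
  "ShBT_P lam mu =
     {T \<in> ShBT_Q lam mu. \<forall>i. (i, i) \<in> skew_SD lam mu \<longrightarrow> \<not> is_primed (fst T (i, i))}"

definition num_bars :: "bar_tableau \<Rightarrow> nat" where
  "num_bars T = card (snd T)"

definition bar_count :: "bar_tableau \<Rightarrow> nat \<Rightarrow> nat" where
  "bar_count T i = card {B \<in> snd T. \<exists>b\<in>B. fst T b \<in> {primed i, unprimed i}}"

text \<open>
  A monomial in \<open>x\<^sub>1, x\<^sub>2, \<dots>\<close> is given by its exponent vector in \<open>nat \<Rightarrow>\<^sub>0 nat\<close>, and a power
  series over \<open>\<int>[\<beta>]\<close> by its coefficient function. The index \<open>0\<close> is unused.
\<close>

definition x_weight :: "bar_tableau \<Rightarrow> (nat \<Rightarrow>\<^sub>0 nat)" where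
  "x_weight T = Abs_poly_mapping (bar_count T)"

type_synonym power_series = "(nat \<Rightarrow>\<^sub>0 nat) \<Rightarrow> int poly"

definition beta :: "int poly" where "beta = [:0, 1:]"

definition jp_comb :: "nat list \<Rightarrow> nat list \<Rightarrow> power_series" where
  "jp_comb lam mu = (\<lambda>m. \<Sum>T\<in>{T \<in> ShBT_P lam mu. x_weight T = m}.
     (- beta) ^ (skew_size lam mu - num_bars T))"

definition jq_comb :: "nat list \<Rightarrow> nat list \<Rightarrow> power_series" where
  "jq_comb lam mu = (\<lambda>m. \<Sum>T\<in>{T \<in> ShBT_Q lam mu. x_weight T = m}.
     (- beta) ^ (skew_size lam mu - num_bars T))"

text \<open>
  Substituting \<open>x\<^bsub>\<pi> i\<^esub>\<close> for \<open>x\<^sub>i\<close> sends the monomial \<open>m \<circ> \<pi>\<close> to \<open>m\<close>.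
\<close>

definition permute_vars :: "(nat \<Rightarrow> nat) \<Rightarrow> power_series \<Rightarrow> power_series" where
  "permute_vars \<pi> f = (\<lambda>m. f (Poly_Mapping.map_key \<pi> m))"

definition symmetric_series :: "power_series \<Rightarrow> bool" where
  "symmetric_series f \<longleftrightarrow> (\<forall>\<pi>. \<pi> permutes {1..} \<longrightarrow> permute_vars \<pi> f = f)"

text \<open>
  The next facts confirm that the coefficients are sums over finite sets, that the weight is
  given by the bar counts, and that the exponents of \<open>- beta\<close> are not truncated.
\<close>

lemma SD_eq_image:
  "SD lam = (\<lambda>(i, j). (i, i + j - 1)) ` (SIGMA i:{1..length lam}. {1..lam ! (i - 1)})"
proof -
  have "x \<in> SD lam \<longleftrightarrow>
      (\<exists>p\<in>(SIGMA i:{1..length lam}. {1..lam ! (i - 1)}). x = (fst p, fst p + snd p - 1))" for x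
    unfolding SD_def Bex_def mem_Sigma_iff split_paired_Ex atLeastAtMost_iff
      mem_Collect_eq fst_conv snd_conv
    by blast
  then show ?thesis
    unfolding image_def case_prod_beta by blast
qed

lemma finite_SD: "finite (SD lam)"
  unfolding SD_eq_image by (intro finite_imageI finite_SigmaI) auto

lemma card_SD: "card (SD lam) = sum_list lam"
proof -
  have "inj_on (\<lambda>(i, j). (i, i + j - 1)) (SIGMA i:{1..length lam}. {1..lam ! (i - 1)})"
    by (auto simp: inj_on_def)
  then have "card (SD lam) = card (SIGMA i:{1..length lam}. {1..lam ! (i - 1)})"
    unfolding SD_eq_image by (rule card_image)
  also have "\<dots> = (\<Sum>i\<in>{1..length lam}. lam ! (i - 1))"
    by (subst card_SigmaI) auto
  also have "\<dots> = (\<Sum>i<length lam. lam ! i)"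
    by (rule sum.reindex_bij_witness[of _ Suc "\<lambda>i. i - 1"]) auto
  also have "\<dots> = sum_list lam"
    by (simp add: sum_list_sum_nth atLeast0LessThan)
  finally show ?thesis .
qed

lemma SD_mono: assumes "part_contained mu lam" shows "SD mu \<subseteq> SD lam"
proof
  fix x assume "x \<in> SD mu"
  then obtain i j where x: "x = (i, i + j - 1)" "1 \<le> i" "i \<le> length mu" "1 \<le> j" "j \<le> mu ! (i - 1)"
    unfolding SD_def by blast
  have "i - 1 < length mu" using x by simp
  then have "mu ! (i - 1) \<le> lam ! (i - 1)" "length mu \<le> length lam"
    using assms unfolding part_contained_def by blast+
  then have "i \<le> length lam" "j \<le> lam ! (i - 1)" using x by simp_all
  then show "x \<in> SD lam" using x unfolding SD_def by blast
qed

lemma card_skew_SD: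
  assumes "part_contained mu lam"
  shows "card (skew_SD lam mu) = skew_size lam mu"
  unfolding skew_SD_def skew_size_def
  by (simp add: card_Diff_subset finite_SD SD_mono[OF assms] card_SD)

lemma finite_skew_SD: "finite (skew_SD lam mu)"
  unfolding skew_SD_def by (simp add: finite_SD)

lemma ShBT_QD:
  assumes "T \<in> ShBT_Q lam mu"
  shows "fst T \<in> skew_SD lam mu \<rightarrow>\<^sub>E entries" "partition_on (skew_SD lam mu) (snd T)"
    "part_contained mu lam"
proof -
  show c: "part_contained mu lam"
    using assms unfolding ShBT_Q_def by (rule_tac ccontr) simp
  then have "T \<in> shifted_bar_tableaux (skew_SD lam mu)"
    using assms unfolding ShBT_Q_def by simp
  note T = this[unfolded shifted_bar_tableaux_def mem_Collect_eq case_prod_beta]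
  show "fst T \<in> skew_SD lam mu \<rightarrow>\<^sub>E entries" by (rule T[THEN conjunct1])
  show "partition_on (skew_SD lam mu) (snd T)"
    by (rule T[THEN conjunct2, THEN conjunct2, THEN conjunct2, THEN conjunct1])
qed

lemma finite_bars: "T \<in> ShBT_Q lam mu \<Longrightarrow> finite (snd T)"
  by (rule finite_elements[OF finite_skew_SD ShBT_QD(2)])

lemma num_bars_le:
  assumes "T \<in> ShBT_Q lam mu"
  shows "num_bars T \<le> skew_size lam mu"
proof -
  note P = ShBT_QD(2)[OF assms]
  have fB: "finite B" if "B \<in> snd T" for B
    using that P finite_skew_SD partition_onD1 finite_subset by (metis Union_upper)
  have "num_bars T = (\<Sum>B\<in>snd T. 1)" unfolding num_bars_def by simp
  also have "\<dots> \<le> (\<Sum>B\<in>snd T. card B)"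
  proof (rule sum_mono)
    fix B assume "B \<in> snd T"
    then have "B \<noteq> {}" "finite B" using P fB by (auto dest: partition_onD3)
    then show "1 \<le> card B" by (simp add: Suc_le_eq card_gt_0_iff)
  qed
  also have "\<dots> = card (\<Union>(snd T))"
    by (rule card_Union_disjoint[symmetric])
      (use partition_onD2[OF P] fB in \<open>simp_all add: disjoint_def pairwise_def disjnt_def\<close>)
  also have "\<dots> = skew_size lam mu"
    using card_skew_SD[OF ShBT_QD(3)[OF assms]] partition_onD1[OF P] by simp
  finally show ?thesis .
qed

lemma bar_count_pos_iff:
  assumes "T \<in> ShBT_Q lam mu"
  shows "bar_count T i \<noteq> 0 \<longleftrightarrow> (\<exists>b\<in>skew_SD lam mu. fst T b \<in> {primed i, unprimed i})"
proof -
  have "bar_count T i \<noteq> 0 \<longleftrightarrow> (\<exists>B\<in>snd T. \<exists>b\<in>B. fst T b \<in> {primed i, unprimed i})"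
    unfolding bar_count_def using finite_bars[OF assms] by (auto simp: card_eq_0_iff)
  also have "\<dots> \<longleftrightarrow> (\<exists>b\<in>\<Union>(snd T). fst T b \<in> {primed i, unprimed i})"
    by blast
  finally show ?thesis
    using partition_onD1[OF ShBT_QD(2)[OF assms]] by simp
qed

lemma lookup_x_weight:
  assumes "T \<in> ShBT_Q lam mu"
  shows "Poly_Mapping.lookup (x_weight T) = bar_count T"
proof -
  have le: "i \<le> e + 1" if "e \<in> {primed i, unprimed i}" for e i
    using that unfolding primed_def unprimed_def by auto
  have "{i. bar_count T i \<noteq> 0} \<subseteq> (\<Union>b\<in>skew_SD lam mu. {i. i \<le> fst T b + 1})"
    using bar_count_pos_iff[OF assms] le by blast
  then have "finite {i. bar_count T i \<noteq> 0}"
    by (rule finite_subset) (simp add: finite_skew_SD)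
  then show ?thesis
    unfolding x_weight_def by (rule lookup_Abs_poly_mapping)
qed

lemma finite_fiber_Q: "finite {T \<in> ShBT_Q lam mu. x_weight T = m}"
proof -
  define K where "K = Poly_Mapping.keys m"
  define E where "E = primed ` K \<union> unprimed ` K"
  let ?D = "skew_SD lam mu"
  have "{T \<in> ShBT_Q lam mu. x_weight T = m} \<subseteq> (?D \<rightarrow>\<^sub>E E) \<times> Pow (Pow ?D)"
  proof
    fix T assume T: "T \<in> {T \<in> ShBT_Q lam mu. x_weight T = m}"
    then have TQ: "T \<in> ShBT_Q lam mu" by simp
    have "fst T b \<in> E" if b: "b \<in> ?D" for b
    proof -
      have "fst T b \<in> entries" using ShBT_QD(1)[OF TQ] b by (rule PiE_mem)
      then obtain i where i: "fst T b \<in> {primed i, unprimed i}" unfolding entries_def by auto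
      then have "bar_count T i \<noteq> 0" using bar_count_pos_iff[OF TQ] b by blast
      then have "i \<in> K" using lookup_x_weight[OF TQ] T unfolding K_def
        by (auto simp: in_keys_iff)
      then show ?thesis using i unfolding E_def by auto
    qed
    then have "fst T \<in> ?D \<rightarrow>\<^sub>E E" using ShBT_QD(1)[OF TQ] by (auto simp: PiE_iff)
    moreover have "snd T \<in> Pow (Pow ?D)"
      using partition_onD1[OF ShBT_QD(2)[OF TQ]] by blast
    ultimately show "T \<in> (?D \<rightarrow>\<^sub>E E) \<times> Pow (Pow ?D)" by (cases T) auto
  qed
  moreover have "finite ((?D \<rightarrow>\<^sub>E E) \<times> Pow (Pow ?D))"
    unfolding E_def K_def by (intro finite_cartesian_product finite_PiE) (auto simp: finite_skew_SD)
  ultimately show ?thesis by (rule finite_subset)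
qed

lemma finite_fiber_P: "finite {T \<in> ShBT_P lam mu. x_weight T = m}"
  by (rule finite_subset[OF _ finite_fiber_Q[of lam mu m]]) (auto simp: ShBT_P_def)

end

theory Submission
  imports Defs
begin

text \<open>
  For a fixed filling the bars can be cut independently, so the sum over all bar partitions is a
  product over the boxes: a box with entry \<open>i\<close> or \<open>i'\<close> contributes \<open>x\<^sub>i\<close>, or \<open>x\<^sub>i - \<beta>\<close> if its right
  neighbour (unprimed entry) or its upper neighbour (primed entry) carries the same entry. By grouping
  the fillings according to the boxes with other entries, symmetry in \<open>x\<^sub>k\<close> and \<open>x\<^sub>k\<^sub>+\<^sub>1\<close> is reduced to
  fillings of an order-convex set of boxes with the four letters \<open>k' < k < (k+1)' < k+1\<close>.

  Such a filling is read diagonal by diagonal, from large to small content. Each diagonal carries at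
  most two boxes, and the vector of generating functions refined by the entries on the current
  diagonal is transformed linearly from one diagonal to the next. Four explicit linear forms in this
  vector (one if the diagonal is empty) are fixed by exchanging the two variables, every transition
  preserves this property, and the final sums, with or without primed entries on the main diagonal,
  are combinations of these forms.
\<close>

section \<open>Weighted fillings\<close>

text \<open>Symmetry of the total sum cannot serve as induction hypothesis on its own: a new box
  interacts with the letters on the previous diagonal, and the sums refined by those letters are not
  symmetric one by one. What survives is a family of linear forms closed under pulling back along
  every transition: a form on the new diagonal is a combination of forms on the old one with
  coefficients symmetric in \<open>x\<close> and \<open>y\<close>. Content is read downwards because
  the right and the upper neighbour of a box, which alone decide its factor, both have content one
  larger, and because the reading then ends on the main diagonal, where the
  \<open>P\<close>-condition amounts to choosing another form. A diagonal carries at most two boxes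
  since entries increase strictly along it and cannot pass from \<open>k'\<close> to
  \<open>k\<close>, so each index occurs at most once. The factor \<open>x - b\<close> records a
  choice at a joined box: it opens a bar of its own, or lengthens its neighbour's bar and trades
  \<open>x\<close> for \<open>- b\<close>. The algebra takes place over an arbitrary commutative
  ring; infinitely many variables return only at the end, since a single coefficient sees finitely
  many of them.\<close>

definition row_rel :: "nat \<Rightarrow> nat \<Rightarrow> bool" where
  "row_rel u v \<longleftrightarrow> u < v \<or> u = v \<and> even u"

definition col_rel :: "nat \<Rightarrow> nat \<Rightarrow> bool" where
  "col_rel u v \<longleftrightarrow> u < v \<or> u = v \<and> odd u"

definition right_entry :: "(nat \<times> nat) set \<Rightarrow> (nat \<times> nat \<Rightarrow> nat) \<Rightarrow> nat \<times> nat \<Rightarrow> nat option" where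
  "right_entry D V p =
     (if (fst p, Suc (snd p)) \<in> D then Some (V (fst p, Suc (snd p))) else None)"

definition upper_entry :: "(nat \<times> nat) set \<Rightarrow> (nat \<times> nat \<Rightarrow> nat) \<Rightarrow> nat \<times> nat \<Rightarrow> nat option" where
  "upper_entry D V p =
     (case fst p of 0 \<Rightarrow> None | Suc k \<Rightarrow> if (k, snd p) \<in> D then Some (V (k, snd p)) else None)"

text \<open>One-sided on purpose: each adjacent pair is tested once, at its left or lower box, which
  is the one of smaller content.\<close>

definition entry_ok :: "nat option \<Rightarrow> nat option \<Rightarrow> nat \<Rightarrow> bool" where
  "entry_ok r u l \<longleftrightarrow> (\<forall>v. r = Some v \<longrightarrow> row_rel l v) \<and> (\<forall>v. u = Some v \<longrightarrow> col_rel v l)"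

definition fillings :: "(nat \<times> nat) set \<Rightarrow> nat set \<Rightarrow> (nat \<times> nat \<Rightarrow> nat) set" where
  "fillings D L = {V \<in> D \<rightarrow>\<^sub>E L. \<forall>p\<in>D. entry_ok (right_entry D V p) (upper_entry D V p) (V p)}"

text \<open>
  In a semistandard filling even (unprimed) bars are horizontal and odd (primed) bars are vertical.
  Cutting the bars at arbitrary places between joined boxes turns the sum over all bar partitions of
  a fixed filling into the product \<open>weight\<close>.
\<close>

definition joined :: "(nat \<times> nat) set \<Rightarrow> (nat \<times> nat \<Rightarrow> nat) \<Rightarrow> nat \<times> nat \<Rightarrow> bool" where
  "joined D V p \<longleftrightarrow> even (V p) \<and> right_entry D V p = Some (V p) \<or>
     odd (V p) \<and> upper_entry D V p = Some (V p)"

definition weight ::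
  "(nat \<Rightarrow> 'a::comm_ring_1) \<Rightarrow> 'a \<Rightarrow> (nat \<times> nat) set \<Rightarrow> (nat \<times> nat \<Rightarrow> nat) \<Rightarrow> 'a" where
  "weight X b D V = (\<Prod>p\<in>D. X (V p) - (if joined D V p then b else 0))"

definition filling_sum ::
  "(nat \<Rightarrow> 'a::comm_ring_1) \<Rightarrow> 'a \<Rightarrow> nat set \<Rightarrow> (nat \<times> nat) set \<Rightarrow> ((nat \<times> nat \<Rightarrow> nat) \<Rightarrow> 'a) \<Rightarrow> 'a"
  where
  "filling_sum X b L D \<phi> = (\<Sum>V\<in>fillings D L. weight X b D V * \<phi> V)"

text \<open>No parity test as in \<open>joined\<close>: under \<open>entry_ok\<close>, equality with
  the right neighbour forces an even letter and equality with the upper neighbour an odd one.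
  Forbidden letters get weight \<open>0\<close>, so sums may run over all of
  \<open>L\<close>.\<close>

definition box_weight ::
  "(nat \<Rightarrow> 'a::comm_ring_1) \<Rightarrow> 'a \<Rightarrow> nat option \<Rightarrow> nat option \<Rightarrow> nat \<Rightarrow> 'a" where
  "box_weight X b r u l =
     (if entry_ok r u l then X l - (if r = Some l \<or> u = Some l then b else 0) else 0)"

lemma finite_fillings: "finite D \<Longrightarrow> finite L \<Longrightarrow> finite (fillings D L)"
  unfolding fillings_def by (rule finite_subset[OF _ finite_PiE[of D "\<lambda>_. L"]]) auto

lemma right_entry_eq_Some:
  "right_entry D V (i, j) = Some v \<longleftrightarrow> (i, Suc j) \<in> D \<and> V (i, Suc j) = v"
  by (auto simp: right_entry_def)

lemma upper_entry_eq_Some: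
  "upper_entry D V (i, j) = Some v \<longleftrightarrow> (\<exists>k. i = Suc k \<and> (k, j) \<in> D \<and> V (k, j) = v)"
  by (auto simp: upper_entry_def split: nat.splits)

lemma right_entry_insert:
  assumes "(fst q, Suc (snd q)) \<noteq> p"
  shows "right_entry (insert p E) (V(p := l)) q = right_entry E V q"
  using assms by (auto simp: right_entry_def)

lemma upper_entry_insert:
  assumes "q \<noteq> (Suc (fst p), snd p)"
  shows "upper_entry (insert p E) (V(p := l)) q = upper_entry E V q"
  using assms by (cases q; cases p) (auto simp: upper_entry_def split: nat.splits)

text \<open>The first hypothesis compares contents: as \<open>snd p - fst p\<close> is minimal,
  \<open>p\<close> is neither the right nor the upper neighbour of an old box.\<close>

lemma joined_insert:
  assumes "\<And>q. q \<in> insert p E \<Longrightarrow> fst q + snd p \<le> fst p + snd q" "q \<in> E" "p \<notin> E"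
  shows "joined (insert p E) (V(p := l)) q \<longleftrightarrow> joined E V q"
proof -
  have "fst q + snd p \<le> fst p + snd q" using assms by blast
  then have 1: "(fst q, Suc (snd q)) \<noteq> p" "q \<noteq> (Suc (fst p), snd p)" by auto
  have "q \<noteq> p" using assms by auto
  then show ?thesis
    by (simp add: joined_def right_entry_insert[OF 1(1)] upper_entry_insert[OF 1(2)])
qed

lemma weight_insert:
  assumes "finite E" "p \<notin> E" "\<And>q. q \<in> E \<Longrightarrow> fst q + snd p \<le> fst p + snd q"
    and "entry_ok (right_entry E V p) (upper_entry E V p) l"
  shows "weight X b (insert p E) (V(p := l)) =
    box_weight X b (right_entry E V p) (upper_entry E V p) l * weight X b E V"
proof -
  have r: "right_entry (insert p E) (V(p := l)) p = right_entry E V p"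
    by (rule right_entry_insert) (metis fst_conv n_not_Suc_n prod.collapse snd_conv)
  have u: "upper_entry (insert p E) (V(p := l)) p = upper_entry E V p"
    by (rule upper_entry_insert) (metis fst_conv n_not_Suc_n)
  have j: "joined (insert p E) (V(p := l)) p \<longleftrightarrow>
      right_entry E V p = Some l \<or> upper_entry E V p = Some l"
    using assms(4) unfolding joined_def r u
    by (auto simp: entry_ok_def row_rel_def col_rel_def)
  have "weight X b (insert p E) (V(p := l)) =
      (X l - (if joined (insert p E) (V(p := l)) p then b else 0)) *
      (\<Prod>q\<in>E. X ((V(p := l)) q) - (if joined (insert p E) (V(p := l)) q then b else 0))"
    unfolding weight_def using assms(1,2) by simp
  also have "(\<Prod>q\<in>E. X ((V(p := l)) q) - (if joined (insert p E) (V(p := l)) q then b else 0)) =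
      weight X b E V"
    unfolding weight_def using assms(2)
    by (intro prod.cong refl arg_cong2[of _ _ _ _ minus] if_cong joined_insert)
      (auto intro: assms(3))
  finally show ?thesis
    unfolding j box_weight_def using assms(4) by (simp only: if_True)
qed

lemma fillings_insert_iff:
  assumes "p \<notin> E" "\<And>q. q \<in> E \<Longrightarrow> fst q + snd p \<le> fst p + snd q"
    and V: "V \<in> extensional E"
  shows "V(p := l) \<in> fillings (insert p E) L \<longleftrightarrow>
    V \<in> fillings E L \<and> l \<in> L \<and> entry_ok (right_entry E V p) (upper_entry E V p) l"
proof -
  have r: "right_entry (insert p E) (V(p := l)) q = right_entry E V q"
    if "q \<in> insert p E" for q
  proof (rule right_entry_insert)
    show "(fst q, Suc (snd q)) \<noteq> p"
      using assms(2)[of q] that by (cases p; cases q) auto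
  qed
  have u: "upper_entry (insert p E) (V(p := l)) q = upper_entry E V q"
    if "q \<in> insert p E" for q
  proof (rule upper_entry_insert)
    show "q \<noteq> (Suc (fst p), snd p)"
      using assms(2)[of q] that by (cases p; cases q) auto
  qed
  have "V(p := l) \<in> insert p E \<rightarrow>\<^sub>E L \<longleftrightarrow> V \<in> E \<rightarrow>\<^sub>E L \<and> l \<in> L"
    using assms(1) V by (auto simp: PiE_iff extensional_def split: if_splits)
  moreover have "(\<forall>q\<in>insert p E. entry_ok (right_entry (insert p E) (V(p := l)) q)
        (upper_entry (insert p E) (V(p := l)) q) ((V(p := l)) q)) \<longleftrightarrow>
      entry_ok (right_entry E V p) (upper_entry E V p) l \<and>
      (\<forall>q\<in>E. entry_ok (right_entry E V q) (upper_entry E V q) (V q))"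
    using assms(1) r u by auto
  ultimately show ?thesis unfolding fillings_def by blast
qed

text \<open>The transfer step: summing out the letter at a new box of minimal content turns the
  functional \<open>\<phi>\<close> on the larger shape into a functional on the smaller one.\<close>

lemma filling_sum_insert:
  assumes fin: "finite E" "finite L"
    and p: "p \<notin> E" "\<And>q. q \<in> E \<Longrightarrow> fst q + snd p \<le> fst p + snd q"
  shows "filling_sum X b L (insert p E) \<phi> = filling_sum X b L E (\<lambda>V. \<Sum>l\<in>L.
    box_weight X b (right_entry E V p) (upper_entry E V p) l * \<phi> (V(p := l)))"
proof -
  let ?ok = "\<lambda>V l. entry_ok (right_entry E V p) (upper_entry E V p) l"
  let ?w = "\<lambda>V l. box_weight X b (right_entry E V p) (upper_entry E V p) l"
  let ?A = "SIGMA V:fillings E L. {l \<in> L. ?ok V l}"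
  have "filling_sum X b L (insert p E) \<phi> =
      (\<Sum>(V, l)\<in>?A. weight X b E V * (?w V l * \<phi> (V(p := l))))"
    unfolding filling_sum_def
  proof (rule sum.reindex_bij_witness[of _ "\<lambda>(V, l). V(p := l)" "\<lambda>V. (restrict V E, V p)"],
      goal_cases)
    case (1 V)
    then have "V \<in> extensional (insert p E)" by (auto simp: fillings_def PiE_iff)
    then show ?case by (auto simp: fun_eq_iff extensional_def)
  next
    case (2 V)
    then have "V \<in> extensional (insert p E)" by (auto simp: fillings_def PiE_iff)
    then have "V = (restrict V E)(p := V p)" by (auto simp: fun_eq_iff extensional_def)
    then have "(restrict V E)(p := V p) \<in> fillings (insert p E) L" using 2 by simp
    then show ?case
      by (subst (asm) fillings_insert_iff[OF p]) auto
  next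
    case (3 a)
    then have "fst a \<in> extensional E" by (auto simp: fillings_def PiE_iff)
    then show ?case using p(1) by (cases a) (auto simp: fun_eq_iff extensional_def)
  next
    case (4 a)
    then have "fst a \<in> extensional E" by (auto simp: fillings_def PiE_iff)
    then show ?case using 4 by (cases a) (auto simp: fillings_insert_iff[OF p])
  next
    case (5 V)
    then have "V \<in> extensional (insert p E)" by (auto simp: fillings_def PiE_iff)
    then have V: "V = (restrict V E)(p := V p)" by (auto simp: fun_eq_iff extensional_def)
    then have "(restrict V E)(p := V p) \<in> fillings (insert p E) L" using 5 by simp
    then have "?ok (restrict V E) (V p)"
      by (subst (asm) fillings_insert_iff[OF p]) auto
    from weight_insert[OF fin(1) p this, where X = X and b = b]
    have "weight X b (insert p E) V = ?w (restrict V E) (V p) * weight X b E (restrict V E)"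
      using V by simp
    then show ?case using V by (simp add: mult_ac)
  qed
  also have "\<dots> = (\<Sum>V\<in>fillings E L. \<Sum>l\<in>{l \<in> L. ?ok V l}. weight X b E V * (?w V l * \<phi> (V(p := l))))"
    by (rule sum.Sigma[symmetric]) (auto simp: finite_fillings fin)
  also have "\<dots> = (\<Sum>V\<in>fillings E L. \<Sum>l\<in>L. weight X b E V * (?w V l * \<phi> (V(p := l))))"
    by (intro sum.cong refl sum.mono_neutral_left) (auto simp: fin box_weight_def)
  finally show ?thesis
    unfolding filling_sum_def by (simp add: sum_distrib_left)
qed

section \<open>Relations fixed by exchanging the two variables\<close>

text \<open>
  Think of \<open>z a\<close> as the generating function, in the variables \<open>x, y\<close>, of the fillings whose only box
  on a given diagonal holds the \<open>a\<close>-th of four consecutive letters, and of \<open>z'\<close> as the same with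
  \<open>x\<close> and \<open>y\<close> exchanged. Starting from the total \<open>z 1 + z 2 + z 3 + z 4\<close>, these are the relations
  forced by pulling back along all possible transitions between neighbouring diagonals. In
  \<open>swap_sym2\<close> the diagonal has two boxes; consecutive letters with the same index cannot occur there.
\<close>

definition swap_sym1 :: "'a::comm_ring_1 \<Rightarrow> 'a \<Rightarrow> 'a \<Rightarrow> (nat \<Rightarrow> 'a) \<Rightarrow> (nat \<Rightarrow> 'a) \<Rightarrow> bool" where
  "swap_sym1 x y b z z' \<longleftrightarrow>
     z 1 + z 3 = z' 1 + z' 3 \<and>
     z 2 + z 4 = z' 2 + z' 4 \<and>
     y * z 2 - x * z 3 = x * z' 2 - y * z' 3 \<and>
     x * y * z 1 - (x - b) * y * z 2 = x * y * z' 1 - (y - b) * x * z' 2"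

definition swap_sym2 ::
  "'a::comm_ring_1 \<Rightarrow> 'a \<Rightarrow> 'a \<Rightarrow> (nat \<Rightarrow> nat \<Rightarrow> 'a) \<Rightarrow> (nat \<Rightarrow> nat \<Rightarrow> 'a) \<Rightarrow> bool" where
  "swap_sym2 x y b w w' \<longleftrightarrow>
     w 1 3 = w' 1 3 \<and>
     w 2 4 = w' 2 4 \<and>
     w 1 4 + w 2 3 = w' 1 4 + w' 2 3 \<and>
     (x + y - b) * w 1 4 + y * (w 2 4 - w 1 3) = (x + y - b) * w' 1 4 + x * (w' 2 4 - w' 1 3)"

text \<open>For a box without neighbours on the previous diagonal the four forms are
  \<open>(x + y) * t\<close> twice, \<open>0\<close> and \<open>b * x * y * t\<close>.\<close>

lemma swap_sym1_start:
  assumes "z 1 = x * t" "z 2 = x * t" "z 3 = y * t" "z 4 = y * t"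
    and "z' 1 = y * t'" "z' 2 = y * t'" "z' 3 = x * t'" "z' 4 = x * t'" and "t = t'"
  shows "swap_sym1 x y b z z'"
  unfolding swap_sym1_def assms by (simp add: algebra_simps)

text \<open>Each form in \<open>z\<close> is a combination of the forms in \<open>v\<close> with
  coefficients symmetric in \<open>x\<close> and \<open>y\<close>; the first line of each chain
  exhibits it. The next three lemmas follow the same pattern.\<close>

lemma swap_sym1_right:
  assumes z: "z 1 = x * (v 2 + v 3 + v 4)" "z 2 = (x - b) * v 2 + x * (v 3 + v 4)"
      "z 3 = y * v 4" "z 4 = (y - b) * v 4"
    and z': "z' 1 = y * (v' 2 + v' 3 + v' 4)" "z' 2 = (y - b) * v' 2 + y * (v' 3 + v' 4)"
      "z' 3 = x * v' 4" "z' 4 = (x - b) * v' 4"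
    and "swap_sym1 x y b v v'"
  shows "swap_sym1 x y b z z'"
proof -
  have h: "v 1 + v 3 = v' 1 + v' 3"
    "v 2 + v 4 = v' 2 + v' 4"
    "y * v 2 - x * v 3 = x * v' 2 - y * v' 3"
    "x * y * v 1 - (x - b) * y * v 2 = x * y * v' 1 - (y - b) * x * v' 2"
    using assms(9) unfolding swap_sym1_def by blast+
  have "z 1 + z 3 = (x + y) * (v 2 + v 4) - (y * v 2 - x * v 3)"
    unfolding z by (simp add: algebra_simps)
  also have "\<dots> = (x + y) * (v' 2 + v' 4) - (x * v' 2 - y * v' 3)"
    by (simp only: h)
  also have "\<dots> = z' 1 + z' 3"
    unfolding z' by (simp add: algebra_simps)
  finally have 1: "z 1 + z 3 = z' 1 + z' 3" .
  have "z 2 + z 4 = (x + y - b) * (v 2 + v 4) - (y * v 2 - x * v 3)"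
    unfolding z by (simp add: algebra_simps)
  also have "\<dots> = (x + y - b) * (v' 2 + v' 4) - (x * v' 2 - y * v' 3)"
    by (simp only: h)
  also have "\<dots> = z' 2 + z' 4"
    unfolding z' by (simp add: algebra_simps)
  finally have 2: "z 2 + z 4 = z' 2 + z' 4" .
  have "y * z 2 - x * z 3 = x * y * (v 1 + v 3) - (x * y * v 1 - (x - b) * y * v 2)"
    unfolding z by (simp add: algebra_simps)
  also have "\<dots> = x * y * (v' 1 + v' 3) - (x * y * v' 1 - (y - b) * x * v' 2)"
    by (simp only: h)
  also have "\<dots> = x * z' 2 - y * z' 3"
    unfolding z' by (simp add: algebra_simps)
  finally have 3: "y * z 2 - x * z 3 = x * z' 2 - y * z' 3" .
  have "x * y * z 1 - (x - b) * y * z 2 = b * (x * y * (v 2 + v 4) + x * y * (v 1 + v 3) - (x * y * v 1 - (x - b) * y * v 2))"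
    unfolding z by (simp add: algebra_simps)
  also have "\<dots> = b * (x * y * (v' 2 + v' 4) + x * y * (v' 1 + v' 3) - (x * y * v' 1 - (y - b) * x * v' 2))"
    by (simp only: h)
  also have "\<dots> = x * y * z' 1 - (y - b) * x * z' 2"
    unfolding z' by (simp add: algebra_simps)
  finally have 4: "x * y * z 1 - (x - b) * y * z 2 = x * y * z' 1 - (y - b) * x * z' 2" .
  show ?thesis
    unfolding swap_sym1_def using 1 2 3 4 by blast
qed

text \<open>Here \<open>z 1\<close> and \<open>z 2\<close> are \<open>x - b\<close> and
  \<open>x\<close> times the same quantity, and the fourth form is built to vanish on such
  pairs.\<close>

lemma swap_sym1_above:
  assumes z: "z 1 = (x - b) * v 1" "z 2 = x * v 1"
      "z 3 = y * (v 1 + v 2) + (y - b) * v 3" "z 4 = y * (v 1 + v 2 + v 3)"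
    and z': "z' 1 = (y - b) * v' 1" "z' 2 = y * v' 1"
      "z' 3 = x * (v' 1 + v' 2) + (x - b) * v' 3" "z' 4 = x * (v' 1 + v' 2 + v' 3)"
    and "swap_sym1 x y b v v'"
  shows "swap_sym1 x y b z z'"
proof -
  have h: "v 1 + v 3 = v' 1 + v' 3"
    "v 2 + v 4 = v' 2 + v' 4"
    "y * v 2 - x * v 3 = x * v' 2 - y * v' 3"
    "x * y * v 1 - (x - b) * y * v 2 = x * y * v' 1 - (y - b) * x * v' 2"
    using assms(9) unfolding swap_sym1_def by blast+
  have "z 1 + z 3 = (x + y - b) * (v 1 + v 3) + (y * v 2 - x * v 3)"
    unfolding z by (simp add: algebra_simps)
  also have "\<dots> = (x + y - b) * (v' 1 + v' 3) + (x * v' 2 - y * v' 3)"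
    by (simp only: h)
  also have "\<dots> = z' 1 + z' 3"
    unfolding z' by (simp add: algebra_simps)
  finally have 1: "z 1 + z 3 = z' 1 + z' 3" .
  have "z 2 + z 4 = (x + y) * (v 1 + v 3) + (y * v 2 - x * v 3)"
    unfolding z by (simp add: algebra_simps)
  also have "\<dots> = (x + y) * (v' 1 + v' 3) + (x * v' 2 - y * v' 3)"
    by (simp only: h)
  also have "\<dots> = z' 2 + z' 4"
    unfolding z' by (simp add: algebra_simps)
  finally have 2: "z 2 + z 4 = z' 2 + z' 4" .
  have "y * z 2 - x * z 3 = (x * y * v 1 - (x - b) * y * v 2) - x * y * (v 1 + v 3) - b * (y * v 2 - x * v 3)"
    unfolding z by (simp add: algebra_simps)
  also have "\<dots> = (x * y * v' 1 - (y - b) * x * v' 2) - x * y * (v' 1 + v' 3) - b * (x * v' 2 - y * v' 3)"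
    by (simp only: h)
  also have "\<dots> = x * z' 2 - y * z' 3"
    unfolding z' by (simp add: algebra_simps)
  finally have 3: "y * z 2 - x * z 3 = x * z' 2 - y * z' 3" .
  have "x * y * z 1 - (x - b) * y * z 2 = 0"
    unfolding z by (simp add: algebra_simps)
  also have "\<dots> = x * y * z' 1 - (y - b) * x * z' 2"
    unfolding z' by (simp add: algebra_simps)
  finally have 4: "x * y * z 1 - (x - b) * y * z 2 = x * y * z' 1 - (y - b) * x * z' 2" .
  show ?thesis
    unfolding swap_sym1_def using 1 2 3 4 by blast
qed

text \<open>The new box lies below the first and to the left of the second old box. No letter fits
  between \<open>k\<close> above and \<open>(k+1)'\<close> on the right, hence \<open>w 2 3\<close>
  does not occur.\<close>

lemma swap_sym1_between:
  assumes z: "z 1 = (x - b) * (w 1 3 + w 1 4)" "z 2 = x * (w 1 3 + w 1 4)"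
      "z 3 = y * (w 1 4 + w 2 4)" "z 4 = (y - b) * (w 1 4 + w 2 4)"
    and z': "z' 1 = (y - b) * (w' 1 3 + w' 1 4)" "z' 2 = y * (w' 1 3 + w' 1 4)"
      "z' 3 = x * (w' 1 4 + w' 2 4)" "z' 4 = (x - b) * (w' 1 4 + w' 2 4)"
    and "swap_sym2 x y b w w'"
  shows "swap_sym1 x y b z z'"
proof -
  have h: "w 1 3 = w' 1 3"
    "w 2 4 = w' 2 4"
    "w 1 4 + w 2 3 = w' 1 4 + w' 2 3"
    "(x + y - b) * w 1 4 + y * (w 2 4 - w 1 3) = (x + y - b) * w' 1 4 + x * (w' 2 4 - w' 1 3)"
    using assms(9) unfolding swap_sym2_def by blast+
  have "z 1 + z 3 = ((x + y - b) * w 1 4 + y * (w 2 4 - w 1 3)) + (x + y - b) * w 1 3"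
    unfolding z by (simp add: algebra_simps)
  also have "\<dots> = ((x + y - b) * w' 1 4 + x * (w' 2 4 - w' 1 3)) + (x + y - b) * w' 1 3"
    by (subst h(4), simp only: h(1,2))
  also have "\<dots> = z' 1 + z' 3"
    unfolding z' by (simp add: algebra_simps)
  finally have 1: "z 1 + z 3 = z' 1 + z' 3" .
  have "z 2 + z 4 = ((x + y - b) * w 1 4 + y * (w 2 4 - w 1 3)) + (x + y) * w 1 3 - b * w 2 4"
    unfolding z by (simp add: algebra_simps)
  also have "\<dots> = ((x + y - b) * w' 1 4 + x * (w' 2 4 - w' 1 3)) + (x + y) * w' 1 3 - b * w' 2 4"
    by (subst h(4), simp only: h(1,2))
  also have "\<dots> = z' 2 + z' 4"
    unfolding z' by (simp add: algebra_simps)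
  finally have 2: "z 2 + z 4 = z' 2 + z' 4" .
  have "y * z 2 - x * z 3 = x * y * (w 1 3 - w 2 4)"
    unfolding z by (simp add: algebra_simps)
  also have "\<dots> = x * y * (w' 1 3 - w' 2 4)"
    by (simp only: h)
  also have "\<dots> = x * z' 2 - y * z' 3"
    unfolding z' by (simp add: algebra_simps)
  finally have 3: "y * z 2 - x * z 3 = x * z' 2 - y * z' 3" .
  have "x * y * z 1 - (x - b) * y * z 2 = 0"
    unfolding z by (simp add: algebra_simps)
  also have "\<dots> = x * y * z' 1 - (y - b) * x * z' 2"
    unfolding z' by (simp add: algebra_simps)
  finally have 4: "x * y * z 1 - (x - b) * y * z 2 = x * y * z' 1 - (y - b) * x * z' 2" .
  show ?thesis
    unfolding swap_sym1_def using 1 2 3 4 by blast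
qed

text \<open>A single old box is the right neighbour of the first and the upper neighbour of the
  second new box. The letters on both sides force it to hold the second or third letter, so only
  \<open>v 2\<close> and \<open>v 3\<close> occur.\<close>

lemma swap_sym2_between:
  assumes w: "w 1 3 = x * y * v 2 + x * (y - b) * v 3" "w 1 4 = x * y * (v 2 + v 3)"
      "w 2 3 = (x - b) * y * v 2 + x * (y - b) * v 3" "w 2 4 = (x - b) * y * v 2 + x * y * v 3"
    and w': "w' 1 3 = y * x * v' 2 + y * (x - b) * v' 3" "w' 1 4 = y * x * (v' 2 + v' 3)"
      "w' 2 3 = (y - b) * x * v' 2 + y * (x - b) * v' 3" "w' 2 4 = (y - b) * x * v' 2 + y * x * v' 3"
    and "swap_sym1 x y b v v'"
  shows "swap_sym2 x y b w w'"
proof -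
  have h: "v 1 + v 3 = v' 1 + v' 3"
    "v 2 + v 4 = v' 2 + v' 4"
    "y * v 2 - x * v 3 = x * v' 2 - y * v' 3"
    "x * y * v 1 - (x - b) * y * v 2 = x * y * v' 1 - (y - b) * x * v' 2"
    using assms(9) unfolding swap_sym1_def by blast+
  have "w 1 3 = x * y * (v 1 + v 3) + b * (y * v 2 - x * v 3) - (x * y * v 1 - (x - b) * y * v 2)"
    unfolding w by (simp add: algebra_simps)
  also have "\<dots> = x * y * (v' 1 + v' 3) + b * (x * v' 2 - y * v' 3) - (x * y * v' 1 - (y - b) * x * v' 2)"
    by (simp only: h)
  also have "\<dots> = w' 1 3"
    unfolding w' by (simp add: algebra_simps)
  finally have 1: "w 1 3 = w' 1 3" .
  have "w 2 4 = x * y * (v 1 + v 3) - (x * y * v 1 - (x - b) * y * v 2)"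
    unfolding w by (simp add: algebra_simps)
  also have "\<dots> = x * y * (v' 1 + v' 3) - (x * y * v' 1 - (y - b) * x * v' 2)"
    by (simp only: h)
  also have "\<dots> = w' 2 4"
    unfolding w' by (simp add: algebra_simps)
  finally have 2: "w 2 4 = w' 2 4" .
  have "w 1 4 + w 2 3 = 2 * x * y * (v 1 + v 3) + b * (y * v 2 - x * v 3) - 2 * (x * y * v 1 - (x - b) * y * v 2)"
    unfolding w by (simp add: algebra_simps)
  also have "\<dots> = 2 * x * y * (v' 1 + v' 3) + b * (x * v' 2 - y * v' 3) - 2 * (x * y * v' 1 - (y - b) * x * v' 2)"
    by (simp only: h)
  also have "\<dots> = w' 1 4 + w' 2 3"
    unfolding w' by (simp add: algebra_simps)
  finally have 3: "w 1 4 + w 2 3 = w' 1 4 + w' 2 3" .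
  have "(x + y - b) * w 1 4 + y * (w 2 4 - w 1 3) = (x + y) * (x * y * (v 1 + v 3) - (x * y * v 1 - (x - b) * y * v 2))"
    unfolding w by (simp add: algebra_simps)
  also have "\<dots> = (x + y) * (x * y * (v' 1 + v' 3) - (x * y * v' 1 - (y - b) * x * v' 2))"
    by (simp only: h)
  also have "\<dots> = (x + y - b) * w' 1 4 + x * (w' 2 4 - w' 1 3)"
    unfolding w' by (simp add: algebra_simps)
  finally have 4: "(x + y - b) * w 1 4 + y * (w 2 4 - w 1 3) = (x + y - b) * w' 1 4 + x * (w' 2 4 - w' 1 3)" .
  show ?thesis
    unfolding swap_sym2_def using 1 2 3 4 by blast
qed

text \<open>Only one pair of letters survives on the previous diagonal, and the fourth form becomes
  \<open>(x + y - b) * (x * y - b * x - b * y) * u 2 4\<close>.\<close>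

lemma swap_sym2_right:
  assumes w: "w 1 3 = x * y * u 2 4" "w 1 4 = x * (y - b) * u 2 4"
      "w 2 3 = (x - b) * y * u 2 4" "w 2 4 = (x - b) * (y - b) * u 2 4"
    and w': "w' 1 3 = y * x * u' 2 4" "w' 1 4 = y * (x - b) * u' 2 4"
      "w' 2 3 = (y - b) * x * u' 2 4" "w' 2 4 = (y - b) * (x - b) * u' 2 4"
    and "swap_sym2 x y b u u'"
  shows "swap_sym2 x y b w w'"
  using assms(9) unfolding swap_sym2_def w w' by (simp add: algebra_simps)

text \<open>The mirror image of the preceding case; the fourth form becomes
  \<open>(x + y - b) * x * y * u 1 3\<close>.\<close>

lemma swap_sym2_above:
  assumes w: "w 1 3 = (x - b) * (y - b) * u 1 3" "w 1 4 = (x - b) * y * u 1 3"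
      "w 2 3 = x * (y - b) * u 1 3" "w 2 4 = x * y * u 1 3"
    and w': "w' 1 3 = (y - b) * (x - b) * u' 1 3" "w' 1 4 = (y - b) * x * u' 1 3"
      "w' 2 3 = y * (x - b) * u' 1 3" "w' 2 4 = y * x * u' 1 3"
    and "swap_sym2 x y b u u'"
  shows "swap_sym2 x y b w w'"
  using assms(9) unfolding swap_sym2_def w w' by (simp add: algebra_simps)

section \<open>Transfer between consecutive diagonals\<close>

text \<open>Order-convexity inside the half-plane \<open>r \<le> s\<close>. It is the property of
  shifted skew shapes that is inherited by the boxes whose entries lie in an interval of
  letters.\<close>

definition shifted_convex :: "(nat \<times> nat) set \<Rightarrow> bool" where
  "shifted_convex D \<longleftrightarrow> (\<forall>p\<in>D. fst p \<le> snd p) \<and>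
     (\<forall>i j k l r s. (i, j) \<in> D \<longrightarrow> (k, l) \<in> D \<longrightarrow> i \<le> r \<longrightarrow> r \<le> k \<longrightarrow> j \<le> s \<longrightarrow> s \<le> l \<longrightarrow>
        r \<le> s \<longrightarrow> (r, s) \<in> D)"

lemma shifted_convexD:
  assumes "shifted_convex D" "(i, j) \<in> D" "(k, l) \<in> D" "i \<le> r" "r \<le> k" "j \<le> s" "s \<le> l" "r \<le> s"
  shows "(r, s) \<in> D"
  using assms unfolding shifted_convex_def by blast

definition diag_rows :: "(nat \<times> nat) set \<Rightarrow> nat \<Rightarrow> nat set" where
  "diag_rows D c = {i. (i, i + c) \<in> D}"

definition content_ge :: "(nat \<times> nat) set \<Rightarrow> nat \<Rightarrow> (nat \<times> nat) set" where
  "content_ge D c = {p \<in> D. fst p + c \<le> snd p}"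

lemma content_ge_Suc:
  "content_ge D c = (\<lambda>i. (i, i + c)) ` diag_rows D c \<union> content_ge D (Suc c)"
proof -
  have "j = i + c \<or> i + Suc c \<le> j" if "i + c \<le> j" for i j :: nat using that by linarith
  then show ?thesis by (fastforce simp: content_ge_def diag_rows_def image_def)
qed

lemma mem_content_ge_Suc:
  "(i, Suc (i + c)) \<in> content_ge D (Suc c) \<longleftrightarrow> i \<in> diag_rows D (Suc c)"
  by (auto simp: content_ge_def diag_rows_def)

text \<open>Convexity fills in corners. In turn: a right neighbour, if some box of the next diagonal
  lies weakly lower; an upper neighbour, if one lies higher; the box to the right of the upper of
  two boxes; the box below the upper of two boxes on the next diagonal.\<close>

lemma diag_rows_adjacent:
  assumes "shifted_convex D"
  shows "i \<in> diag_rows D c \<Longrightarrow> k \<in> diag_rows D (Suc c) \<Longrightarrow> i \<le> k \<Longrightarrow> i \<in> diag_rows D (Suc c)"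
    and "Suc i \<in> diag_rows D c \<Longrightarrow> k \<in> diag_rows D (Suc c) \<Longrightarrow> k < Suc i \<Longrightarrow> i \<in> diag_rows D (Suc c)"
    and "i \<in> diag_rows D c \<Longrightarrow> i' \<in> diag_rows D c \<Longrightarrow> i < i' \<Longrightarrow> i \<in> diag_rows D (Suc c)"
    and "k \<in> diag_rows D (Suc c) \<Longrightarrow> k' \<in> diag_rows D (Suc c) \<Longrightarrow> k < k' \<Longrightarrow> Suc k \<in> diag_rows D c"
  unfolding diag_rows_def mem_Collect_eq
  subgoal by (rule shifted_convexD[OF assms, of i "i + c" k "k + Suc c"]) auto
  subgoal by (rule shifted_convexD[OF assms, of k "k + Suc c" "Suc i" "Suc i + c"]) auto
  subgoal by (rule shifted_convexD[OF assms, of i "i + c" i' "i' + c"]) auto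
  subgoal by (rule shifted_convexD[OF assms, of k "k + Suc c" k' "k' + Suc c"]) auto
  done

lemma filling_sum_cong:
  "(\<And>V. V \<in> fillings D L \<Longrightarrow> \<phi> V = \<psi> V) \<Longrightarrow> filling_sum X b L D \<phi> = filling_sum X b L D \<psi>"
  unfolding filling_sum_def by (rule sum.cong) auto

lemma filling_sum_add:
  "filling_sum X b L D (\<lambda>V. \<phi> V + \<psi> V) = filling_sum X b L D \<phi> + filling_sum X b L D \<psi>"
  unfolding filling_sum_def by (simp add: distrib_left sum.distrib)

lemma filling_sum_mult:
  "filling_sum X b L D (\<lambda>V. h * \<phi> V) = h * filling_sum X b L D \<phi>"
  unfolding filling_sum_def by (simp add: sum_distrib_left mult_ac)

lemma fillings_mem: "V \<in> fillings D L \<Longrightarrow> p \<in> D \<Longrightarrow> V p \<in> L"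
  unfolding fillings_def by (auto simp: PiE_iff)

lemma fillings_row_rel:
  assumes "V \<in> fillings D L" "(i, j) \<in> D" "(i, Suc j) \<in> D"
  shows "row_rel (V (i, j)) (V (i, Suc j))"
proof -
  have "entry_ok (right_entry D V (i, j)) (upper_entry D V (i, j)) (V (i, j))"
    using assms unfolding fillings_def by blast
  then show ?thesis using assms(3) by (simp add: entry_ok_def right_entry_def)
qed

lemma fillings_col_rel:
  assumes "V \<in> fillings D L" "(i, j) \<in> D" "(Suc i, j) \<in> D"
  shows "col_rel (V (i, j)) (V (Suc i, j))"
proof -
  have "entry_ok (right_entry D V (Suc i, j)) (upper_entry D V (Suc i, j)) (V (Suc i, j))"
    using assms unfolding fillings_def by blast
  then show ?thesis using assms(2) by (simp add: entry_ok_def upper_entry_def)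
qed

text \<open>The box \<open>(i, Suc j)\<close> mediates. Equality in its row needs an even letter and
  equality in its column an odd one, so the two steps cannot both be equalities; starting from an
  odd letter the first step is strict, and if it gains only one, the letter reached is even and the
  second step is strict too.\<close>

lemma fillings_diag:
  assumes "V \<in> fillings D L" "(i, j) \<in> D" "(i, Suc j) \<in> D" "(Suc i, Suc j) \<in> D"
  shows "V (i, j) < V (Suc i, Suc j)"
    and "odd (V (i, j)) \<Longrightarrow> Suc (Suc (V (i, j))) \<le> V (Suc i, Suc j)"
  using fillings_row_rel[OF assms(1-3)] fillings_col_rel[OF assms(1,3,4)]
  unfolding row_rel_def col_rel_def by presburger+

text \<open>For \<open>e = 2 * m\<close> these are
  \<open>(m+1)' < m+1 < (m+2)' < m+2\<close>.\<close>

definition four_letters :: "nat \<Rightarrow> nat set" where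
  "four_letters e = {e + 1, e + 2, e + 3, e + 4}"

definition two_weights :: "nat \<Rightarrow> 'a \<Rightarrow> 'a \<Rightarrow> nat \<Rightarrow> 'a" where
  "two_weights e x y v = (if v \<le> e + 2 then x else y)"

lemma fillings_diag_cases:
  assumes "even e" "V \<in> fillings D (four_letters e)"
    and "(i, j) \<in> D" "(i, Suc j) \<in> D" "(Suc i, Suc j) \<in> D"
  shows "(V (i, j), V (Suc i, Suc j)) \<in> {(e+1, e+3), (e+1, e+4), (e+2, e+3), (e+2, e+4)}"
proof -
  have "V (i, j) \<in> four_letters e" "V (Suc i, Suc j) \<in> four_letters e"
    using assms by (auto intro: fillings_mem)
  moreover note fillings_diag[OF assms(2-5)]
  ultimately show ?thesis using assms(1) by (auto simp: four_letters_def)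
qed

text \<open>Of two consecutive boxes on a diagonal the first holds one of the two lower letters and
  the second one of the two upper letters; the middle one of three boxes would have to do
  both.\<close>

lemma fillings_long_diag_empty:
  assumes "even e" "shifted_convex D" "i \<in> diag_rows D c" "k \<in> diag_rows D c" "Suc i < k"
  shows "fillings D (four_letters e) = {}"
proof (rule ccontr)
  assume "fillings D (four_letters e) \<noteq> {}"
  then obtain V where V: "V \<in> fillings D (four_letters e)" by blast
  have b: "(i, i + c) \<in> D" "(k, k + c) \<in> D" using assms by (auto simp: diag_rows_def)
  have m: "(r, s) \<in> D" if "i \<le> r" "r \<le> k" "i + c \<le> s" "s \<le> k + c" "r \<le> s" for r s
    by (rule shifted_convexD[OF assms(2) b that])
  have 1: "(V (i, i + c), V (Suc i, Suc (i + c))) \<in> {(e+1, e+3), (e+1, e+4), (e+2, e+3), (e+2, e+4)}"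
    by (rule fillings_diag_cases[OF assms(1) V]) (rule m; use assms(5) in simp)+
  have "(V (Suc i, Suc (i + c)), V (Suc (Suc i), Suc (Suc (i + c))))
      \<in> {(e+1, e+3), (e+1, e+4), (e+2, e+3), (e+2, e+4)}"
    by (rule fillings_diag_cases[OF assms(1) V]) (rule m; use assms(5) in simp)+
  with 1 show False by auto
qed

definition diag_sum1 where
  "diag_sum1 e b x y E p a =
     filling_sum (two_weights e x y) b (four_letters e) E (\<lambda>V. of_bool (V p = e + a))"

definition diag_sum2 where
  "diag_sum2 e b x y E p q a a' =
     filling_sum (two_weights e x y) b (four_letters e) E (\<lambda>V. of_bool (V p = e + a \<and> V q = e + a'))"

lemma filling_sum_expand1:
  assumes "p \<in> E"
  shows "filling_sum (two_weights e x y) b (four_letters e) E (\<lambda>V. h (V p)) =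
    h (e + 1) * diag_sum1 e b x y E p 1 + h (e + 2) * diag_sum1 e b x y E p 2 +
    h (e + 3) * diag_sum1 e b x y E p 3 + h (e + 4) * diag_sum1 e b x y E p 4"
proof -
  have "V p \<in> four_letters e" if "V \<in> fillings E (four_letters e)" for V
    using that assms by (rule fillings_mem)
  then show ?thesis
    unfolding diag_sum1_def filling_sum_add[symmetric] filling_sum_mult[symmetric]
    by (intro filling_sum_cong) (force simp: four_letters_def)
qed

lemma filling_sum_expand2:
  assumes "even e" "(i, j) \<in> E" "(i, Suc j) \<in> E" "(Suc i, Suc j) \<in> E"
  shows "filling_sum (two_weights e x y) b (four_letters e) E (\<lambda>V. h (V (i, j)) (V (Suc i, Suc j))) =
    h (e + 1) (e + 3) * diag_sum2 e b x y E (i, j) (Suc i, Suc j) 1 3 +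
    h (e + 1) (e + 4) * diag_sum2 e b x y E (i, j) (Suc i, Suc j) 1 4 +
    h (e + 2) (e + 3) * diag_sum2 e b x y E (i, j) (Suc i, Suc j) 2 3 +
    h (e + 2) (e + 4) * diag_sum2 e b x y E (i, j) (Suc i, Suc j) 2 4"
  unfolding diag_sum2_def filling_sum_add[symmetric] filling_sum_mult[symmetric]
  by (intro filling_sum_cong) (use fillings_diag_cases[OF assms(1) _ assms(2-4)] in force)

lemma finite_four_letters: "finite (four_letters e)"
  by (simp add: four_letters_def)

lemma filling_sum_insert_select:
  assumes "finite E" "finite L" "p \<notin> E" "\<And>q. q \<in> E \<Longrightarrow> fst q + snd p \<le> fst p + snd q" "l \<in> L"
  shows "filling_sum X b L (insert p E) (\<lambda>V. of_bool (V p = l) * \<phi> V) = filling_sum X b L E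
    (\<lambda>V. box_weight X b (right_entry E V p) (upper_entry E V p) l * \<phi> (V(p := l)))"
proof -
  have "(\<Sum>l'\<in>L. box_weight X b r u l' * (of_bool (l' = l) * \<psi> l')) = box_weight X b r u l * \<psi> l"
    for r u \<psi>
  proof -
    have "(\<Sum>l'\<in>L. box_weight X b r u l' * (of_bool (l' = l) * \<psi> l')) =
        (\<Sum>l'\<in>L. if l = l' then box_weight X b r u l * \<psi> l else 0)"
      by (rule sum.cong) auto
    then show ?thesis using assms(2,5) by (simp add: sum.delta')
  qed
  then show ?thesis
    by (subst filling_sum_insert[OF assms(1-4)]) simp_all
qed

lemma diag_sum1_insert:
  assumes "finite E" "p \<notin> E" "\<And>q. q \<in> E \<Longrightarrow> fst q + snd p \<le> fst p + snd q"
    and "e + a \<in> four_letters e"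
  shows "diag_sum1 e b x y (insert p E) p a =
    filling_sum (two_weights e x y) b (four_letters e) E
      (\<lambda>V. box_weight (two_weights e x y) b (right_entry E V p) (upper_entry E V p) (e + a))"
  unfolding diag_sum1_def
  using filling_sum_insert_select[OF assms(1) finite_four_letters assms(2-4), where \<phi> = "\<lambda>_. 1"]
  by simp

text \<open>Boxes on the same diagonal are not neighbours, so both factors can be computed from the
  old shape and multiplied.\<close>

lemma diag_sum2_insert:
  fixes i c :: nat
  assumes E: "finite E" "\<And>q. q \<in> E \<Longrightarrow> fst q + Suc c \<le> snd q"
    and a: "e + a \<in> four_letters e" "e + a' \<in> four_letters e"
  defines "p \<equiv> (i, i + c)" and "q \<equiv> (Suc i, Suc (i + c))"
  shows "diag_sum2 e b x y (insert p (insert q E)) p q a a' =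
    filling_sum (two_weights e x y) b (four_letters e) E
      (\<lambda>V. box_weight (two_weights e x y) b (right_entry E V p) (upper_entry E V p) (e + a) *
        box_weight (two_weights e x y) b (right_entry E V q) (upper_entry E V q) (e + a'))"
proof -
  have 1: "r \<noteq> p" "r \<noteq> q" "fst r + c < snd r" if "r \<in> E" for r
    using E(2)[OF that] by (auto simp: p_def q_def)
  have notin: "p \<notin> E" "q \<notin> E" using 1(1)[of p] 1(2)[of q] by blast+
  have ne: "p \<noteq> q" by (simp add: p_def q_def)
  have pos1: "fst r + snd q \<le> fst q + snd r" if "r \<in> E" for r
    using 1(3)[OF that] by (simp add: q_def)
  have pos2: "fst r + snd p \<le> fst p + snd r" if "r \<in> insert q E" for r
    using 1(3)[of r] that by (auto simp: p_def q_def)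
  have r: "right_entry (insert q E) (V(q := l)) p = right_entry E V p" for V l
    by (rule right_entry_insert) (simp add: p_def q_def)
  have u: "upper_entry (insert q E) (V(q := l)) p = upper_entry E V p" for V l
    by (rule upper_entry_insert) (simp add: p_def q_def)
  let ?w = "\<lambda>V p. box_weight (two_weights e x y) b (right_entry E V p) (upper_entry E V p)"
  have "diag_sum2 e b x y (insert p (insert q E)) p q a a' =
      filling_sum (two_weights e x y) b (four_letters e) (insert q E)
        (\<lambda>V. box_weight (two_weights e x y) b (right_entry (insert q E) V p)
          (upper_entry (insert q E) V p) (e + a) * of_bool (V q = e + a'))"
    unfolding diag_sum2_def of_bool_conj
    using filling_sum_insert_select[where E = "insert q E" and \<phi> = "\<lambda>V. of_bool (V q = e + a')",
        OF _ finite_four_letters _ pos2 a(1)] E(1) notin ne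
    by simp
  also have "\<dots> = filling_sum (two_weights e x y) b (four_letters e) E
      (\<lambda>V. ?w V p (e + a) * ?w V q (e + a'))"
    using filling_sum_insert_select[OF E(1) finite_four_letters notin(2) pos1 a(2),
        where \<phi> = "\<lambda>V. box_weight (two_weights e x y) b (right_entry (insert q E) V p)
          (upper_entry (insert q E) V p) (e + a)"]
    by (simp add: r u mult_ac)
  finally show ?thesis .
qed

lemma right_entry_None: "(i, Suc j) \<notin> E \<Longrightarrow> right_entry E V (i, j) = None"
  by (simp add: right_entry_def)

lemma right_entry_Some: "(i, Suc j) \<in> E \<Longrightarrow> right_entry E V (i, j) = Some (V (i, Suc j))"
  by (simp add: right_entry_def)

lemma upper_entry_None: "(\<And>k. i = Suc k \<Longrightarrow> (k, j) \<notin> E) \<Longrightarrow> upper_entry E V (i, j) = None"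
  by (simp add: upper_entry_def split: nat.splits)

lemma upper_entry_Some: "(i, j) \<in> E \<Longrightarrow> upper_entry E V (Suc i, j) = Some (V (i, j))"
  by (simp add: upper_entry_def)

lemmas transfer_simps = box_weight_def entry_ok_def row_rel_def col_rel_def two_weights_def

section \<open>Transition rules for the possible relative positions of two neighbouring
  diagonals\<close>

context
  fixes e c :: nat and b :: "'a::comm_ring_1" and E :: "(nat \<times> nat) set"
  assumes e: "even e" and finE: "finite E"
    and content: "\<And>q. q \<in> E \<Longrightarrow> fst q + Suc c \<le> snd q"
begin

lemma diag_box_insertable:
  "(i, i + c) \<notin> E" "q \<in> E \<Longrightarrow> fst q + snd (i, i + c) \<le> fst (i, i + c) + snd q"
  using content by fastforce+

lemma diag_sum1_insert_box:
  assumes "a \<in> {1, 2, 3, 4}"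
  shows "diag_sum1 e b x y (insert (i, i + c) E) (i, i + c) a =
    filling_sum (two_weights e x y) b (four_letters e) E
      (\<lambda>V. box_weight (two_weights e x y) b (right_entry E V (i, i + c)) (upper_entry E V (i, i + c)) (e + a))"
  by (rule diag_sum1_insert[OF finE diag_box_insertable]) (use assms in \<open>auto simp: four_letters_def\<close>)

lemma diag_sum2_insert_boxes:
  assumes "a \<in> {1, 2, 3, 4}" "a' \<in> {1, 2, 3, 4}"
  shows "diag_sum2 e b x y (insert (i, i + c) (insert (Suc i, Suc (i + c)) E)) (i, i + c) (Suc i, Suc (i + c)) a a' =
    filling_sum (two_weights e x y) b (four_letters e) E
      (\<lambda>V. box_weight (two_weights e x y) b (right_entry E V (i, i + c)) (upper_entry E V (i, i + c)) (e + a) *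
        box_weight (two_weights e x y) b (right_entry E V (Suc i, Suc (i + c)))
          (upper_entry E V (Suc i, Suc (i + c))) (e + a'))"
  by (rule diag_sum2_insert[OF finE content]) (use assms in \<open>auto simp: four_letters_def\<close>)

text \<open>Here and below the sums are functions of \<open>x\<close> and \<open>y\<close>, so that
  each rule can be used a second time with the variables exchanged.\<close>

lemma diag_sum1_isolated:
  assumes "(i, Suc (i + c)) \<notin> E" "\<And>k. i = Suc k \<Longrightarrow> (k, i + c) \<notin> E"
  defines "z \<equiv> \<lambda>x y. diag_sum1 e b x y (insert (i, i + c) E) (i, i + c)"
    and "t \<equiv> \<lambda>x y. filling_sum (two_weights e x y) b (four_letters e) E (\<lambda>_. 1)"
  shows "z x y 1 = x * t x y" "z x y 2 = x * t x y" "z x y 3 = y * t x y" "z x y 4 = y * t x y"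
proof -
  have "z x y a = box_weight (two_weights e x y) b None None (e + a) * t x y"
    if "a \<in> {1, 2, 3, 4}" for a
    unfolding z_def t_def diag_sum1_insert_box[OF that] filling_sum_mult[symmetric]
    by (simp add: right_entry_None assms(1) upper_entry_None[OF assms(2)])
  then show "z x y 1 = x * t x y" "z x y 2 = x * t x y" "z x y 3 = y * t x y" "z x y 4 = y * t x y"
    by (simp_all add: transfer_simps)
qed

lemma diag_sum1_right:
  assumes "(i, Suc (i + c)) \<in> E" "\<And>k. i = Suc k \<Longrightarrow> (k, i + c) \<notin> E"
  defines "z \<equiv> \<lambda>x y. diag_sum1 e b x y (insert (i, i + c) E) (i, i + c)"
    and "v \<equiv> \<lambda>x y. diag_sum1 e b x y E (i, Suc (i + c))"
  shows "z x y 1 = x * (v x y 2 + v x y 3 + v x y 4)"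
    "z x y 2 = (x - b) * v x y 2 + x * (v x y 3 + v x y 4)"
    "z x y 3 = y * v x y 4" "z x y 4 = (y - b) * v x y 4"
proof -
  let ?w = "\<lambda>g a. box_weight (two_weights e x y) b (Some g) None (e + a)"
  \<comment> \<open>A row of the transfer matrix. Its entries are then evaluated from the parity of
    \<open>e\<close>; forbidden pairs of letters give \<open>0\<close>.\<close>
  have "z x y a = ?w (e + 1) a * v x y 1 + ?w (e + 2) a * v x y 2 +
      ?w (e + 3) a * v x y 3 + ?w (e + 4) a * v x y 4"
    if "a \<in> {1, 2, 3, 4}" for a
    unfolding z_def v_def diag_sum1_insert_box[OF that]
      filling_sum_expand1[OF assms(1), symmetric, where h = "\<lambda>g. ?w g a"]
    by (simp add: right_entry_Some assms(1) upper_entry_None[OF assms(2)])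
  then show "z x y 1 = x * (v x y 2 + v x y 3 + v x y 4)"
    "z x y 2 = (x - b) * v x y 2 + x * (v x y 3 + v x y 4)"
    "z x y 3 = y * v x y 4" "z x y 4 = (y - b) * v x y 4"
    using e by (simp_all add: transfer_simps algebra_simps)
qed

lemma diag_sum1_above:
  assumes "(k, Suc (k + c)) \<in> E" "(Suc k, Suc (Suc k + c)) \<notin> E"
  defines "z \<equiv> \<lambda>x y. diag_sum1 e b x y (insert (Suc k, Suc k + c) E) (Suc k, Suc k + c)"
    and "v \<equiv> \<lambda>x y. diag_sum1 e b x y E (k, Suc (k + c))"
  shows "z x y 1 = (x - b) * v x y 1" "z x y 2 = x * v x y 1"
      "z x y 3 = y * (v x y 1 + v x y 2) + (y - b) * v x y 3"
      "z x y 4 = y * (v x y 1 + v x y 2 + v x y 3)"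
proof -
  let ?w = "\<lambda>g a. box_weight (two_weights e x y) b None (Some g) (e + a)"
  have "z x y a = ?w (e + 1) a * v x y 1 + ?w (e + 2) a * v x y 2 +
      ?w (e + 3) a * v x y 3 + ?w (e + 4) a * v x y 4"
    if "a \<in> {1, 2, 3, 4}" for a
    unfolding z_def v_def diag_sum1_insert_box[OF that]
      filling_sum_expand1[OF assms(1), symmetric, where h = "\<lambda>g. ?w g a"]
    using right_entry_None[OF assms(2)] upper_entry_Some[OF assms(1)] by simp
  then show "z x y 1 = (x - b) * v x y 1" "z x y 2 = x * v x y 1"
      "z x y 3 = y * (v x y 1 + v x y 2) + (y - b) * v x y 3"
      "z x y 4 = y * (v x y 1 + v x y 2 + v x y 3)"
    using e by (simp_all add: transfer_simps algebra_simps)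
qed

lemma diag_sum1_between:
  assumes "(k, Suc (k + c)) \<in> E" "(k, Suc (Suc (k + c))) \<in> E" "(Suc k, Suc (Suc (k + c))) \<in> E"
  defines "z \<equiv> \<lambda>x y. diag_sum1 e b x y (insert (Suc k, Suc k + c) E) (Suc k, Suc k + c)"
    and "w \<equiv> \<lambda>x y. diag_sum2 e b x y E (k, Suc (k + c)) (Suc k, Suc (Suc (k + c)))"
  shows "z x y 1 = (x - b) * (w x y 1 3 + w x y 1 4)" "z x y 2 = x * (w x y 1 3 + w x y 1 4)"
      "z x y 3 = y * (w x y 1 4 + w x y 2 4)" "z x y 4 = (y - b) * (w x y 1 4 + w x y 2 4)"
proof -
  let ?w = "\<lambda>g h a. box_weight (two_weights e x y) b (Some h) (Some g) (e + a)"
  have "z x y a = ?w (e + 1) (e + 3) a * w x y 1 3 + ?w (e + 1) (e + 4) a * w x y 1 4 +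
      ?w (e + 2) (e + 3) a * w x y 2 3 + ?w (e + 2) (e + 4) a * w x y 2 4"
    if "a \<in> {1, 2, 3, 4}" for a
    unfolding z_def w_def diag_sum1_insert_box[OF that]
      filling_sum_expand2[OF e assms(1-3), symmetric, where h = "\<lambda>g h. ?w g h a"]
    using right_entry_Some[OF assms(3)] upper_entry_Some[OF assms(1)] by simp
  then show "z x y 1 = (x - b) * (w x y 1 3 + w x y 1 4)" "z x y 2 = x * (w x y 1 3 + w x y 1 4)"
      "z x y 3 = y * (w x y 1 4 + w x y 2 4)" "z x y 4 = (y - b) * (w x y 1 4 + w x y 2 4)"
    using e by (simp_all add: transfer_simps algebra_simps)
qed

lemma diag_sum2_between:
  assumes "(i, Suc (i + c)) \<in> E" "(Suc i, Suc (Suc (i + c))) \<notin> E"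
    "\<And>k. i = Suc k \<Longrightarrow> (k, i + c) \<notin> E"
  defines "w \<equiv> \<lambda>x y. diag_sum2 e b x y (insert (i, i + c) (insert (Suc i, Suc (i + c)) E))
      (i, i + c) (Suc i, Suc (i + c))"
    and "v \<equiv> \<lambda>x y. diag_sum1 e b x y E (i, Suc (i + c))"
  shows "w x y 1 3 = x * y * v x y 2 + x * (y - b) * v x y 3"
      "w x y 1 4 = x * y * (v x y 2 + v x y 3)"
      "w x y 2 3 = (x - b) * y * v x y 2 + x * (y - b) * v x y 3"
      "w x y 2 4 = (x - b) * y * v x y 2 + x * y * v x y 3"
proof -
  let ?w = "\<lambda>g a a'. box_weight (two_weights e x y) b (Some g) None (e + a) *
    box_weight (two_weights e x y) b None (Some g) (e + a')"
  have "w x y a a' = ?w (e + 1) a a' * v x y 1 + ?w (e + 2) a a' * v x y 2 +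
      ?w (e + 3) a a' * v x y 3 + ?w (e + 4) a a' * v x y 4"
    if "a \<in> {1, 2, 3, 4}" "a' \<in> {1, 2, 3, 4}" for a a'
    unfolding w_def v_def diag_sum2_insert_boxes[OF that]
      filling_sum_expand1[OF assms(1), symmetric, where h = "\<lambda>g. ?w g a a'"]
    using right_entry_Some[OF assms(1)] right_entry_None[OF assms(2)]
      upper_entry_Some[OF assms(1)] upper_entry_None[OF assms(3)] by simp
  then show "w x y 1 3 = x * y * v x y 2 + x * (y - b) * v x y 3"
      "w x y 1 4 = x * y * (v x y 2 + v x y 3)"
      "w x y 2 3 = (x - b) * y * v x y 2 + x * (y - b) * v x y 3"
      "w x y 2 4 = (x - b) * y * v x y 2 + x * y * v x y 3"
    using e by (simp_all add: transfer_simps algebra_simps)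
qed

lemma diag_sum2_right:
  assumes "(i, Suc (i + c)) \<in> E" "(i, Suc (Suc (i + c))) \<in> E" "(Suc i, Suc (Suc (i + c))) \<in> E"
    "\<And>k. i = Suc k \<Longrightarrow> (k, i + c) \<notin> E"
  defines "w \<equiv> \<lambda>x y. diag_sum2 e b x y (insert (i, i + c) (insert (Suc i, Suc (i + c)) E))
      (i, i + c) (Suc i, Suc (i + c))"
    and "u \<equiv> \<lambda>x y. diag_sum2 e b x y E (i, Suc (i + c)) (Suc i, Suc (Suc (i + c)))"
  shows "w x y 1 3 = x * y * u x y 2 4" "w x y 1 4 = x * (y - b) * u x y 2 4"
      "w x y 2 3 = (x - b) * y * u x y 2 4" "w x y 2 4 = (x - b) * (y - b) * u x y 2 4"
proof -
  let ?w = "\<lambda>g h a a'. box_weight (two_weights e x y) b (Some g) None (e + a) *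
    box_weight (two_weights e x y) b (Some h) (Some g) (e + a')"
  have "w x y a a' = ?w (e + 1) (e + 3) a a' * u x y 1 3 + ?w (e + 1) (e + 4) a a' * u x y 1 4 +
      ?w (e + 2) (e + 3) a a' * u x y 2 3 + ?w (e + 2) (e + 4) a a' * u x y 2 4"
    if "a \<in> {1, 2, 3, 4}" "a' \<in> {1, 2, 3, 4}" for a a'
    unfolding w_def u_def diag_sum2_insert_boxes[OF that]
      filling_sum_expand2[OF e assms(1-3), symmetric, where h = "\<lambda>g h. ?w g h a a'"]
    using right_entry_Some[OF assms(1)] right_entry_Some[OF assms(3)]
      upper_entry_Some[OF assms(1)] upper_entry_None[OF assms(4)] by simp
  then show "w x y 1 3 = x * y * u x y 2 4" "w x y 1 4 = x * (y - b) * u x y 2 4"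
      "w x y 2 3 = (x - b) * y * u x y 2 4" "w x y 2 4 = (x - b) * (y - b) * u x y 2 4"
    using e by (simp_all add: transfer_simps algebra_simps)
qed

lemma diag_sum2_above:
  assumes "(k, Suc (k + c)) \<in> E" "(k, Suc (Suc (k + c))) \<in> E" "(Suc k, Suc (Suc (k + c))) \<in> E"
    "(Suc (Suc k), Suc (Suc (Suc k + c))) \<notin> E"
  defines "w \<equiv> \<lambda>x y. diag_sum2 e b x y (insert (Suc k, Suc k + c) (insert (Suc (Suc k), Suc (Suc k + c)) E))
      (Suc k, Suc k + c) (Suc (Suc k), Suc (Suc k + c))"
    and "u \<equiv> \<lambda>x y. diag_sum2 e b x y E (k, Suc (k + c)) (Suc k, Suc (Suc (k + c)))"
  shows "w x y 1 3 = (x - b) * (y - b) * u x y 1 3" "w x y 1 4 = (x - b) * y * u x y 1 3"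
      "w x y 2 3 = x * (y - b) * u x y 1 3" "w x y 2 4 = x * y * u x y 1 3"
proof -
  let ?w = "\<lambda>g h a a'. box_weight (two_weights e x y) b (Some h) (Some g) (e + a) *
    box_weight (two_weights e x y) b None (Some h) (e + a')"
  have "w x y a a' = ?w (e + 1) (e + 3) a a' * u x y 1 3 + ?w (e + 1) (e + 4) a a' * u x y 1 4 +
      ?w (e + 2) (e + 3) a a' * u x y 2 3 + ?w (e + 2) (e + 4) a a' * u x y 2 4"
    if "a \<in> {1, 2, 3, 4}" "a' \<in> {1, 2, 3, 4}" for a a'
    unfolding w_def u_def diag_sum2_insert_boxes[OF that]
      filling_sum_expand2[OF e assms(1-3), symmetric, where h = "\<lambda>g h. ?w g h a a'"]
    using right_entry_Some[OF assms(3)] right_entry_None[OF assms(4)]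
      upper_entry_Some[OF assms(1)] upper_entry_Some[OF assms(3)] by simp
  then show "w x y 1 3 = (x - b) * (y - b) * u x y 1 3" "w x y 1 4 = (x - b) * y * u x y 1 3"
      "w x y 2 3 = x * (y - b) * u x y 1 3" "w x y 2 4 = x * y * u x y 1 3"
    using e by (simp_all add: transfer_simps algebra_simps)
qed

end

section \<open>Induction over the diagonals and the symmetry for four letters\<close>

lemma swap_sym1_total:
  assumes "swap_sym1 x y b z z'"
  shows "z 1 + z 2 + z 3 + z 4 = z' 1 + z' 2 + z' 3 + z' 4"
proof -
  have "z 1 + z 2 + z 3 + z 4 = (z 1 + z 3) + (z 2 + z 4)" by (simp add: add_ac)
  also have "\<dots> = (z' 1 + z' 3) + (z' 2 + z' 4)" using assms by (simp add: swap_sym1_def)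
  also have "\<dots> = z' 1 + z' 2 + z' 3 + z' 4" by (simp add: add_ac)
  finally show ?thesis .
qed

text \<open>The invariant, with one clause per number of boxes on the diagonal. An empty diagonal
  decouples the boxes read so far from the rest, so there the plain total suffices.\<close>

definition level_sym :: "nat \<Rightarrow> 'a::comm_ring_1 \<Rightarrow> 'a \<Rightarrow> 'a \<Rightarrow> (nat \<times> nat) set \<Rightarrow> nat \<Rightarrow> bool" where
  "level_sym e b x y D c \<longleftrightarrow>
     (diag_rows D c = {} \<longrightarrow>
       filling_sum (two_weights e x y) b (four_letters e) (content_ge D c) (\<lambda>_. 1) =
       filling_sum (two_weights e y x) b (four_letters e) (content_ge D c) (\<lambda>_. 1)) \<and>
     (\<forall>i. diag_rows D c = {i} \<longrightarrow>
       swap_sym1 x y b (diag_sum1 e b x y (content_ge D c) (i, i + c))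
         (diag_sum1 e b y x (content_ge D c) (i, i + c))) \<and>
     (\<forall>i. diag_rows D c = {i, Suc i} \<longrightarrow>
       swap_sym2 x y b (diag_sum2 e b x y (content_ge D c) (i, i + c) (Suc i, Suc (i + c)))
         (diag_sum2 e b y x (content_ge D c) (i, i + c) (Suc i, Suc (i + c))))"

text \<open>Convexity and thinness leave seven ways in which a nonempty diagonal can continue the
  one read before it, one for each transition lemma on \<open>swap_sym1\<close> and
  \<open>swap_sym2\<close>.\<close>

lemma level_sym_step:
  assumes e: "even e" and D: "finite D" "shifted_convex D"
    and thin: "\<And>c. diag_rows D c = {} \<or> (\<exists>i. diag_rows D c = {i}) \<or> (\<exists>i. diag_rows D c = {i, Suc i})"
    and IH: "level_sym e b x y D (Suc c)"
  shows "level_sym e b x y D c"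
proof -
  define E where "E = content_ge D (Suc c)"
  let ?R = "diag_rows D c" and ?R' = "diag_rows D (Suc c)"
  have finE: "finite E" using D(1) by (simp add: E_def content_ge_def)
  have content: "fst q + Suc c \<le> snd q" if "q \<in> E" for q
    using that by (simp add: E_def content_ge_def)
  note ctx = e finE content
  note adj = diag_rows_adjacent[OF D(2), of _ c]
  have right: "(i, Suc (i + c)) \<in> E \<longleftrightarrow> i \<in> ?R'" for i
    by (simp add: E_def mem_content_ge_Suc)
  have up: "(k, i + c) \<notin> E" if "k \<notin> ?R'" "i = Suc k" for i k
    using that right[of k] by simp
  have mid: "(k, Suc (Suc (k + c))) \<in> E" if "k \<in> ?R'" "Suc k \<in> ?R'" for k
  proof -
    have "(k, Suc (Suc (k + c))) \<in> D"
      by (rule shifted_convexD[OF D(2), of k "k + Suc c" "Suc k" "Suc k + Suc c"])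
        (use that in \<open>auto simp: diag_rows_def\<close>)
    then show ?thesis by (simp add: E_def content_ge_def)
  qed
  have tot: "filling_sum (two_weights e x y) b (four_letters e) E (\<lambda>_. 1) =
       filling_sum (two_weights e y x) b (four_letters e) E (\<lambda>_. 1)" if "?R' = {}"
    using IH that by (simp add: level_sym_def E_def)
  have s1: "swap_sym1 x y b (diag_sum1 e b x y E (k, Suc (k + c))) (diag_sum1 e b y x E (k, Suc (k + c)))"
    if "?R' = {k}" for k
    using IH that by (simp add: level_sym_def E_def)
  have s2: "swap_sym2 x y b (diag_sum2 e b x y E (k, Suc (k + c)) (Suc k, Suc (Suc (k + c))))
      (diag_sum2 e b y x E (k, Suc (k + c)) (Suc k, Suc (Suc (k + c))))"
    if "?R' = {k, Suc k}" for k
    using IH that by (simp add: level_sym_def E_def)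
  have part0: "filling_sum (two_weights e x y) b (four_letters e) (content_ge D c) (\<lambda>_. 1) =
       filling_sum (two_weights e y x) b (four_letters e) (content_ge D c) (\<lambda>_. 1)"
    if R: "?R = {}"
  proof -
    have cE: "content_ge D c = E" using R by (simp add: content_ge_Suc[of D c] E_def)
    consider "?R' = {}" | k where "?R' = {k}" | k where "?R' = {k, Suc k}"
      using thin[of "Suc c"] by blast
    then show ?thesis
    proof cases
      case 1
      then show ?thesis unfolding cE by (rule tot)
    next
      case (2 k)
      then have kE: "(k, Suc (k + c)) \<in> E" by (simp add: right)
      show ?thesis
        using swap_sym1_total[OF s1[OF 2]] filling_sum_expand1[OF kE, of e x y b "\<lambda>_. 1"]
          filling_sum_expand1[OF kE, of e y x b "\<lambda>_. 1"]
        unfolding cE by simp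
    next
      case (3 k)
      have "Suc k \<in> ?R" by (rule adj(4)[of _ "Suc k"]) (use 3 in auto)
      then show ?thesis using R by simp
    qed
  qed
  have part1: "swap_sym1 x y b (diag_sum1 e b x y (content_ge D c) (i, i + c))
         (diag_sum1 e b y x (content_ge D c) (i, i + c))"
    if R: "?R = {i}" for i
  proof -
    have cE: "content_ge D c = insert (i, i + c) E"
      using R by (simp add: content_ge_Suc[of D c] E_def)
    consider "?R' = {}" | k where "?R' = {k}" | k where "?R' = {k, Suc k}"
      using thin[of "Suc c"] by blast
    then show ?thesis
    proof cases
      case 1
      have i: "(i, Suc (i + c)) \<notin> E" "\<And>k. i = Suc k \<Longrightarrow> (k, i + c) \<notin> E"
        using 1 by (simp_all add: right up)
      show ?thesis
        unfolding cE
        by (rule swap_sym1_start[OF diag_sum1_isolated[OF ctx i] diag_sum1_isolated[OF ctx i] tot[OF 1]])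
    next
      case (2 k)
      show ?thesis
      proof (cases "i \<le> k")
        case True
        \<comment> \<open>Weakly above the old box, the new one has a right neighbour, which must be
          the old box; otherwise the old box is its upper neighbour.\<close>
        have "i \<in> ?R'" by (rule adj(1)[of _ k]) (use R 2 True in auto)
        then have k: "?R' = {i}" using 2 by simp
        have i: "(i, Suc (i + c)) \<in> E" "\<And>k. i = Suc k \<Longrightarrow> (k, i + c) \<notin> E"
          by (simp add: right k) (rule up, simp_all add: k)
        show ?thesis
          unfolding cE
          by (rule swap_sym1_right[OF diag_sum1_right[OF ctx i] diag_sum1_right[OF ctx i] s1[OF k]])
      next
        case False
        then obtain j where j: "i = Suc j" by (cases i) auto
        have "j \<in> ?R'" by (rule adj(2)[of _ k]) (use R 2 False j in auto)
        then have k: "?R' = {j}" using 2 by simp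
        have i: "(j, Suc (j + c)) \<in> E" "(Suc j, Suc (Suc j + c)) \<notin> E"
          by (simp_all only: right k) auto
        show ?thesis
          unfolding cE j
          by (rule swap_sym1_above[OF diag_sum1_above[OF ctx i] diag_sum1_above[OF ctx i] s1[OF k]])
      qed
    next
      case (3 k)
      have "Suc k \<in> ?R" by (rule adj(4)[of _ "Suc k"]) (use 3 in auto)
      then have j: "i = Suc k" using R by simp
      have i: "(k, Suc (k + c)) \<in> E" "(k, Suc (Suc (k + c))) \<in> E" "(Suc k, Suc (Suc (k + c))) \<in> E"
        using right[of "Suc k"] by (auto simp: right mid 3)
      show ?thesis
        unfolding cE j
        by (rule swap_sym1_between[OF diag_sum1_between[OF ctx i] diag_sum1_between[OF ctx i] s2[OF 3]])
    qed
  qed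
  have part2: "swap_sym2 x y b (diag_sum2 e b x y (content_ge D c) (i, i + c) (Suc i, Suc (i + c)))
         (diag_sum2 e b y x (content_ge D c) (i, i + c) (Suc i, Suc (i + c)))"
    if R: "?R = {i, Suc i}" for i
  proof -
    have cE: "content_ge D c = insert (i, i + c) (insert (Suc i, Suc (i + c)) E)"
      using R by (simp add: content_ge_Suc[of D c] E_def)
    have "i \<in> ?R'" by (rule adj(3)[of _ "Suc i"]) (use R in auto)
    \<comment> \<open>A pair of consecutive rows containing \<open>i\<close> either starts or ends
      with \<open>i\<close>.\<close>
    then have "?R' = {i} \<or> ?R' = {i, Suc i} \<or> (\<exists>k. ?R' = {k, Suc k} \<and> i = Suc k)"
      using thin[of "Suc c"] by (elim disjE exE) auto
    then consider "?R' = {i}" | "?R' = {i, Suc i}" | k where "?R' = {k, Suc k}" "i = Suc k"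
      by (elim disjE exE conjE)
    then show ?thesis
    proof cases
      case 1
      have i: "(i, Suc (i + c)) \<in> E" "(Suc i, Suc (Suc (i + c))) \<notin> E"
        "\<And>k. i = Suc k \<Longrightarrow> (k, i + c) \<notin> E"
        using right[of "Suc i"] by (auto simp: right 1 intro!: up)
      show ?thesis
        unfolding cE
        by (rule swap_sym2_between[OF diag_sum2_between[OF ctx i] diag_sum2_between[OF ctx i] s1[OF 1]])
    next
      case 2
      have i: "(i, Suc (i + c)) \<in> E" "(i, Suc (Suc (i + c))) \<in> E" "(Suc i, Suc (Suc (i + c))) \<in> E"
        "\<And>k. i = Suc k \<Longrightarrow> (k, i + c) \<notin> E"
        using right[of "Suc i"] by (auto simp: right mid 2 intro!: up)
      show ?thesis
        unfolding cE
        by (rule swap_sym2_right[OF diag_sum2_right[OF ctx i] diag_sum2_right[OF ctx i] s2[OF 2]])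
    next
      case (3 k)
      have i: "(k, Suc (k + c)) \<in> E" "(k, Suc (Suc (k + c))) \<in> E" "(Suc k, Suc (Suc (k + c))) \<in> E"
        "(Suc (Suc k), Suc (Suc (Suc k + c))) \<notin> E"
        using right[of "Suc k"] right[of "Suc (Suc k)"] by (auto simp: right mid 3)
      show ?thesis
        unfolding cE 3
        by (rule swap_sym2_above[OF diag_sum2_above[OF ctx i] diag_sum2_above[OF ctx i] s2[OF 3(1)]])
    qed
  qed
  show ?thesis
    unfolding level_sym_def using part0 part1 part2 by blast
qed

lemma level_sym_0:
  assumes e: "even e" and D: "finite D" "shifted_convex D"
    and thin: "\<And>c. diag_rows D c = {} \<or> (\<exists>i. diag_rows D c = {i}) \<or> (\<exists>i. diag_rows D c = {i, Suc i})"
  shows "level_sym e b x y D 0"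
proof -
  \<comment> \<open>\<open>K\<close> exceeds every column, so no box has content at least
    \<open>K\<close> and the invariant holds trivially there.\<close>
  define K where "K = Suc (\<Sum>p\<in>D. snd p)"
  have "snd p < K" if "p \<in> D" for p
    unfolding K_def less_Suc_eq_le using D(1) that by (intro member_le_sum) auto
  then have "content_ge D K = {}" "diag_rows D K = {}"
    by (fastforce simp: content_ge_def diag_rows_def)+
  then have "level_sym e b x y D K"
    by (simp add: level_sym_def filling_sum_def weight_def)
  moreover have "0 \<le> K" by simp
  ultimately show ?thesis
    by (induction rule: inc_induct[rotated]) (auto intro: level_sym_step[OF assms])
qed

text \<open>The flag distinguishes the \<open>P\<close>-version (\<open>True\<close>) from the \<open>Q\<close>-version (\<open>False\<close>).\<close>

definition diag_even :: "bool \<Rightarrow> (nat \<times> nat) set \<Rightarrow> (nat \<times> nat \<Rightarrow> nat) \<Rightarrow> bool" where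
  "diag_even fl D V \<longleftrightarrow> (fl \<longrightarrow> (\<forall>i. (i, i) \<in> D \<longrightarrow> even (V (i, i))))"

text \<open>The \<open>Q\<close>-total is the sum of the first two forms in
  \<open>swap_sym1\<close>, or of the first three in \<open>swap_sym2\<close>. The
  \<open>P\<close>-condition keeps even letters only, leaving the forms \<open>z 2 + z 4\<close> and
  \<open>w 2 4\<close>.\<close>

lemma two_letter_symmetry:
  assumes e: "even e" and D: "finite D" "shifted_convex D"
  shows "filling_sum (two_weights e x y) b (four_letters e) D (\<lambda>V. of_bool (diag_even fl D V)) =
    filling_sum (two_weights e y x) b (four_letters e) D (\<lambda>V. of_bool (diag_even fl D V))"
proof (cases "\<exists>c i k. i \<in> diag_rows D c \<and> k \<in> diag_rows D c \<and> Suc i < k")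
  case True
  then have "fillings D (four_letters e) = {}"
    using fillings_long_diag_empty[OF e D(2)] by blast
  then show ?thesis by (simp add: filling_sum_def)
next
  case False
  have thin: "diag_rows D c = {} \<or> (\<exists>i. diag_rows D c = {i}) \<or> (\<exists>i. diag_rows D c = {i, Suc i})" for c
  proof (cases "diag_rows D c = {}")
    case ne: False
    define i where "i = (LEAST i. i \<in> diag_rows D c)"
    have i: "i \<in> diag_rows D c" unfolding i_def using ne by (metis LeastI ex_in_conv)
    have "k = i \<or> k = Suc i" if "k \<in> diag_rows D c" for k
    proof -
      have "i \<le> k" unfolding i_def using that by (rule Least_le)
      moreover have "\<not> Suc i < k" using False i that by blast
      ultimately show ?thesis by linarith
    qed
    then show ?thesis using i by blast
  qed simp
  note lev = level_sym_0[OF e D thin, of b x y, unfolded level_sym_def]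
  have D0: "content_ge D 0 = D"
    using D(2) by (auto simp: content_ge_def shifted_convex_def)
  have mem: "(i, i) \<in> D \<longleftrightarrow> i \<in> diag_rows D 0" for i by (simp add: diag_rows_def)
  consider "diag_rows D 0 = {}" | i where "diag_rows D 0 = {i}" | i where "diag_rows D 0 = {i, Suc i}"
    using thin[of 0] by blast
  then show ?thesis
  proof cases
    case 1
    then show ?thesis using lev by (simp add: D0 diag_even_def mem)
  next
    case (2 i)
    then have iD: "(i, i) \<in> D" by (simp add: mem)
    have eq: "(\<lambda>V. of_bool (diag_even fl D V) :: 'a) = (\<lambda>V. of_bool (fl \<longrightarrow> even (V (i, i))))"
      by (simp add: diag_even_def mem 2)
    have s: "swap_sym1 x y b (diag_sum1 e b x y D (i, i)) (diag_sum1 e b y x D (i, i))"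
      using lev 2 by (simp add: D0)
    note exp = filling_sum_expand1[OF iD, where h = "\<lambda>v. of_bool (fl \<longrightarrow> even v)"]
    show ?thesis
    proof (cases fl)
      case True
      then show ?thesis
        unfolding eq exp using s e unfolding swap_sym1_def by simp
    next
      case False
      then show ?thesis
        unfolding eq exp using swap_sym1_total[OF s] by simp
    qed
  next
    case (3 i)
    then have iD: "(i, i) \<in> D" "(i, Suc i) \<in> D" "(Suc i, Suc i) \<in> D"
      using shifted_convexD[OF D(2), of i i "Suc i" "Suc i" i "Suc i"] by (simp_all add: mem)
    have eq: "(\<lambda>V. of_bool (diag_even fl D V) :: 'a) =
        (\<lambda>V. of_bool (fl \<longrightarrow> even (V (i, i)) \<and> even (V (Suc i, Suc i))))"
      by (auto simp add: diag_even_def mem 3 fun_eq_iff)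
    have s: "swap_sym2 x y b (diag_sum2 e b x y D (i, i) (Suc i, Suc i)) (diag_sum2 e b y x D (i, i) (Suc i, Suc i))"
      using lev 3 by (simp add: D0)
    note exp = filling_sum_expand2[OF e iD, where h = "\<lambda>v v'. of_bool (fl \<longrightarrow> even v \<and> even v')"]
    show ?thesis
      unfolding eq exp using s e unfolding swap_sym2_def
      by (cases fl) (simp_all add: add.assoc)
  qed
qed

section \<open>Exchanging adjacent variables\<close>

lemma fillings_iff:
  "V \<in> fillings D L \<longleftrightarrow> V \<in> D \<rightarrow>\<^sub>E L \<and>
     (\<forall>i j. (i, j) \<in> D \<longrightarrow> (i, Suc j) \<in> D \<longrightarrow> row_rel (V (i, j)) (V (i, Suc j))) \<and>
     (\<forall>i j. (i, j) \<in> D \<longrightarrow> (Suc i, j) \<in> D \<longrightarrow> col_rel (V (i, j)) (V (Suc i, j)))"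
proof -
  have "(\<forall>p\<in>D. entry_ok (right_entry D V p) (upper_entry D V p) (V p)) \<longleftrightarrow>
     (\<forall>i j. (i, j) \<in> D \<longrightarrow> (i, Suc j) \<in> D \<longrightarrow> row_rel (V (i, j)) (V (i, Suc j))) \<and>
     (\<forall>i j. (i, j) \<in> D \<longrightarrow> (Suc i, j) \<in> D \<longrightarrow> col_rel (V (i, j)) (V (Suc i, j)))"
    by (fastforce simp: entry_ok_def right_entry_eq_Some upper_entry_eq_Some)
  then show ?thesis unfolding fillings_def by blast
qed

lemma fillings_row_mono:
  assumes D: "shifted_convex D" and V: "V \<in> fillings D L" and ij: "(i, j) \<in> D"
  shows "j \<le> k \<Longrightarrow> (i, k) \<in> D \<Longrightarrow> V (i, j) \<le> V (i, k)"
proof (induction k rule: dec_induct)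
  case (step k)
  have "i \<le> j" using D ij by (auto simp: shifted_convex_def)
  then have k: "(i, k) \<in> D"
    by (intro shifted_convexD[OF D ij step.prems]) (use step.hyps in auto)
  show ?case
    using step.IH[OF k] fillings_row_rel[OF V k step.prems] by (auto simp: row_rel_def)
qed simp

lemma fillings_col_mono:
  assumes D: "shifted_convex D" and V: "V \<in> fillings D L" and ij: "(i, j) \<in> D"
  shows "i \<le> k \<Longrightarrow> (k, j) \<in> D \<Longrightarrow> V (i, j) \<le> V (k, j)"
proof (induction k rule: dec_induct)
  case (step k)
  have "Suc k \<le> j" using D step.prems by (auto simp: shifted_convex_def)
  then have k: "(k, j) \<in> D"
    by (intro shifted_convexD[OF D ij step.prems]) (use step.hyps in auto)
  show ?case
    using step.IH[OF k] fillings_col_rel[OF V k step.prems] by (auto simp: col_rel_def)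
qed simp

text \<open>The path turns at the upper right corner \<open>(i, l)\<close>; the lower left corner
  could fall below the main diagonal.\<close>

lemma fillings_mono:
  assumes D: "shifted_convex D" and V: "V \<in> fillings D L"
    and "(i, j) \<in> D" "(k, l) \<in> D" "i \<le> k" "j \<le> l"
  shows "V (i, j) \<le> V (k, l)"
proof -
  have "i \<le> j" using D assms(3) by (auto simp: shifted_convex_def)
  then have "(i, l) \<in> D"
    by (intro shifted_convexD[OF D assms(3,4)]) (use assms(5,6) in auto)
  then show ?thesis
    using fillings_row_mono[OF D V assms(3), of l] fillings_col_mono[OF D V, of i l k] assms
    by fastforce
qed

lemma shifted_convex_letters:
  assumes D: "shifted_convex D" and V: "V \<in> fillings D L"
  shows "shifted_convex {p \<in> D. V p \<in> four_letters e}"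
  unfolding shifted_convex_def
proof (intro conjI allI impI ballI)
  fix p assume "p \<in> {p \<in> D. V p \<in> four_letters e}"
  then show "fst p \<le> snd p" using D by (auto simp: shifted_convex_def)
next
  fix i j k l r s
  assume *: "(i, j) \<in> {p \<in> D. V p \<in> four_letters e}" "(k, l) \<in> {p \<in> D. V p \<in> four_letters e}"
    "i \<le> r" "r \<le> k" "j \<le> s" "s \<le> l" "r \<le> s"
  from * have rs: "(r, s) \<in> D"
    using shifted_convexD[OF D, of i j k l r s] by simp
  have "V (i, j) \<le> V (r, s)" "V (r, s) \<le> V (k, l)"
    using * rs by (auto intro!: fillings_mono[OF D V])
  then have "e + 1 \<le> V (r, s)" "V (r, s) \<le> e + 4"
    using * by (auto simp: four_letters_def)
  then have "V (r, s) \<in> four_letters e" unfolding four_letters_def by auto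
  then show "(r, s) \<in> {p \<in> D. V p \<in> four_letters e}" using rs by simp
qed

lemma filling_sum_weight_cong:
  assumes "\<And>v. v \<in> L \<Longrightarrow> X v = Y v"
  shows "filling_sum X b L D \<phi> = filling_sum Y b L D \<phi>"
  unfolding filling_sum_def weight_def
  by (intro sum.cong prod.cong arg_cong2[of _ _ _ _ times] arg_cong2[of _ _ _ _ minus] refl assms)
    (rule fillings_mem)

text \<open>The value \<open>0\<close>, which is not a letter, marks the boxes with entries in \<open>M\<close>.\<close>

definition outer_key :: "nat set \<Rightarrow> (nat \<times> nat) set \<Rightarrow> (nat \<times> nat \<Rightarrow> nat) \<Rightarrow> (nat \<times> nat \<Rightarrow> nat)" where
  "outer_key M D V = (\<lambda>p\<in>D. if V p \<in> M then 0 else V p)"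

lemma row_rel_letters:
  "u \<in> four_letters e \<Longrightarrow> u' \<in> four_letters e \<Longrightarrow> v \<notin> four_letters e \<Longrightarrow> row_rel u v \<Longrightarrow> row_rel u' v"
  "u \<in> four_letters e \<Longrightarrow> u' \<in> four_letters e \<Longrightarrow> v \<notin> four_letters e \<Longrightarrow> row_rel v u \<Longrightarrow> row_rel v u'"
  unfolding four_letters_def row_rel_def by auto

lemma col_rel_letters:
  "u \<in> four_letters e \<Longrightarrow> u' \<in> four_letters e \<Longrightarrow> v \<notin> four_letters e \<Longrightarrow> col_rel u v \<Longrightarrow> col_rel u' v"
  "u \<in> four_letters e \<Longrightarrow> u' \<in> four_letters e \<Longrightarrow> v \<notin> four_letters e \<Longrightarrow> col_rel v u \<Longrightarrow> col_rel v u'"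
  unfolding four_letters_def col_rel_def by auto

text \<open>Four consecutive letters compare alike with every other letter, so the boxes in
  \<open>D'\<close> can be refilled independently of the rest. Joined boxes have equal entries,
  hence no joint crosses the boundary of \<open>D'\<close> and the weight factorises.\<close>

lemma fiber_filling_sum:
  fixes X :: "nat \<Rightarrow> 'a::comm_ring_1"
  assumes D: "finite D" and L: "four_letters e \<subseteq> L" "0 \<notin> L" and V0: "V0 \<in> fillings D L"
  defines "M \<equiv> four_letters e"
  defines "U \<equiv> outer_key M D V0"
  defines "D' \<equiv> {p \<in> D. V0 p \<in> M}"
  shows "(\<Sum>V\<in>{V \<in> fillings D L. outer_key M D V = U}. weight X b D V * of_bool (diag_even fl D V)) =
    (\<Prod>p\<in>D - D'. X (V0 p) - (if joined D V0 p then b else 0)) *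
    of_bool (diag_even fl (D - D') V0) * filling_sum X b M D' (\<lambda>V. of_bool (diag_even fl D' V))"
    (is "_ = ?out * ?ev * _")
proof -
  have V0L: "V0 \<in> D \<rightarrow>\<^sub>E L" using V0 by (simp add: fillings_def)
  have key_eq: "outer_key M D V = U \<longleftrightarrow> (\<forall>p\<in>D. (V p \<in> M \<longleftrightarrow> V0 p \<in> M) \<and> (V0 p \<notin> M \<longrightarrow> V p = V0 p))"
    if "V \<in> D \<rightarrow>\<^sub>E L" for V
  proof -
    have "V p \<noteq> 0" "V0 p \<noteq> 0" if "p \<in> D" for p
      using \<open>V \<in> D \<rightarrow>\<^sub>E L\<close> V0L that L(2) by (metis PiE_mem)+
    moreover have "outer_key M D V = U \<longleftrightarrow>
        (\<forall>p\<in>D. (if V p \<in> M then 0 else V p) = (if V0 p \<in> M then 0 else V0 p))"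
      unfolding U_def outer_key_def by (auto simp: fun_eq_iff restrict_def)
    ultimately show ?thesis by (metis (full_types))
  qed
  let ?S = "{V \<in> fillings D L. outer_key M D V = U}"
  have S: "V \<in> fillings D L" "V \<in> D \<rightarrow>\<^sub>E L" "\<And>p. p \<in> D' \<Longrightarrow> V p \<in> M"
    "\<And>p. p \<in> D \<Longrightarrow> p \<notin> D' \<Longrightarrow> V p = V0 p \<and> V0 p \<notin> M" if "V \<in> ?S" for V
  proof -
    show 1: "V \<in> fillings D L" using that by simp
    then show 2: "V \<in> D \<rightarrow>\<^sub>E L" by (simp add: fillings_def)
    show "\<And>p. p \<in> D' \<Longrightarrow> V p \<in> M" "\<And>p. p \<in> D \<Longrightarrow> p \<notin> D' \<Longrightarrow> V p = V0 p \<and> V0 p \<notin> M"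
      using key_eq[OF 2] that by (auto simp: D'_def)
  qed
  let ?m = "\<lambda>W p. if p \<in> D' then W p else V0 p"
  have D'D: "D' \<subseteq> D" by (auto simp: D'_def)
  have merge: "?m W \<in> ?S" if W: "W \<in> fillings D' M" for W
  proof -
    have WM: "W p \<in> M" if "p \<in> D'" for p using W that by (rule fillings_mem)
    have V0D': "V0 p \<in> M \<longleftrightarrow> p \<in> D'" if "p \<in> D" for p using that by (simp add: D'_def)
    have mE: "?m W \<in> D \<rightarrow>\<^sub>E L"
      using V0L WM L(1) D'D by (auto simp: M_def PiE_iff extensional_def)
    have "row_rel (?m W (i, j)) (?m W (i, Suc j))" if a: "(i, j) \<in> D" "(i, Suc j) \<in> D" for i j
    proof -
      note V0_rel = fillings_row_rel[OF V0 a] and letters = row_rel_letters[of _ e, folded M_def]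
      consider "(i, j) \<in> D'" "(i, Suc j) \<in> D'" | "(i, j) \<in> D'" "(i, Suc j) \<notin> D'"
        | "(i, j) \<notin> D'" "(i, Suc j) \<in> D'" | "(i, j) \<notin> D'" "(i, Suc j) \<notin> D'" by blast
      then show ?thesis
      proof cases
        case 1
        then show ?thesis using fillings_row_rel[OF W] by simp
      next
        case 2
        then have "row_rel (W (i, j)) (V0 (i, Suc j))"
          by (intro letters(1)[OF _ _ _ V0_rel]) (use WM V0D' a in auto)
        then show ?thesis using 2 by simp
      next
        case 3
        then have "row_rel (V0 (i, j)) (W (i, Suc j))"
          by (intro letters(2)[OF _ _ _ V0_rel]) (use WM V0D' a in auto)
        then show ?thesis using 3 by simp
      next
        case 4
        then show ?thesis using V0_rel by simp
      qed
    qed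
    moreover have "col_rel (?m W (i, j)) (?m W (Suc i, j))" if a: "(i, j) \<in> D" "(Suc i, j) \<in> D" for i j
    proof -
      note V0_rel = fillings_col_rel[OF V0 a] and letters = col_rel_letters[of _ e, folded M_def]
      consider "(i, j) \<in> D'" "(Suc i, j) \<in> D'" | "(i, j) \<in> D'" "(Suc i, j) \<notin> D'"
        | "(i, j) \<notin> D'" "(Suc i, j) \<in> D'" | "(i, j) \<notin> D'" "(Suc i, j) \<notin> D'" by blast
      then show ?thesis
      proof cases
        case 1
        then show ?thesis using fillings_col_rel[OF W] by simp
      next
        case 2
        then have "col_rel (W (i, j)) (V0 (Suc i, j))"
          by (intro letters(1)[OF _ _ _ V0_rel]) (use WM V0D' a in auto)
        then show ?thesis using 2 by simp
      next
        case 3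
        then have "col_rel (V0 (i, j)) (W (Suc i, j))"
          by (intro letters(2)[OF _ _ _ V0_rel]) (use WM V0D' a in auto)
        then show ?thesis using 3 by simp
      next
        case 4
        then show ?thesis using V0_rel by simp
      qed
    qed
    ultimately have "?m W \<in> fillings D L" unfolding fillings_iff using mE by blast
    moreover have "outer_key M D (?m W) = U"
      unfolding key_eq[OF mE] using WM V0D' by auto
    ultimately show ?thesis by simp
  qed
  have joined_in: "joined D V p \<longleftrightarrow> joined D' (restrict V D') p" if V: "V \<in> ?S" and p: "p \<in> D'" for V p
  proof -
    \<comment> \<open>Equal entries lie on the same side of the boundary, so a neighbour lost by
      passing to \<open>D'\<close> was not joined.\<close>
    have "q \<in> D' \<longleftrightarrow> q \<in> D" if "V q = V p" for q
      using S(3)[OF V p] S(4)[OF V, of q] that D'D by (metis subsetD)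
    then have "right_entry D V p = Some (V p) \<longleftrightarrow> right_entry D' (restrict V D') p = Some (V p)"
      "upper_entry D V p = Some (V p) \<longleftrightarrow> upper_entry D' (restrict V D') p = Some (V p)"
      by (cases p; auto simp: right_entry_eq_Some upper_entry_eq_Some)+
    then show ?thesis using p by (simp add: joined_def)
  qed
  have joined_out: "joined D V p \<longleftrightarrow> joined D V0 p" if V: "V \<in> ?S" and p: "p \<in> D - D'" for V p
  proof -
    have "V q = V p \<longleftrightarrow> V0 q = V0 p" if "q \<in> D" for q
      using S(4)[OF V, of p] S(4)[OF V, of q] S(3)[OF V, of q] that p D'D
      by (cases "q \<in> D'") (auto simp: D'_def)
    moreover have "V p = V0 p" using S(4)[OF V, of p] p by simp
    ultimately show ?thesis
      by (cases p) (auto simp: joined_def right_entry_eq_Some upper_entry_eq_Some)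
  qed
  have weight_split: "weight X b D V = ?out * weight X b D' (restrict V D')" if V: "V \<in> ?S" for V
  proof -
    have "weight X b D V = (\<Prod>p\<in>D - D'. X (V p) - (if joined D V p then b else 0)) *
        (\<Prod>p\<in>D'. X (V p) - (if joined D V p then b else 0))"
      unfolding weight_def by (rule prod.subset_diff[OF D'D D])
    also have "(\<Prod>p\<in>D - D'. X (V p) - (if joined D V p then b else 0)) = ?out"
      using S(4)[OF V] joined_out[OF V] by (intro prod.cong) auto
    also have "(\<Prod>p\<in>D'. X (V p) - (if joined D V p then b else 0)) = weight X b D' (restrict V D')"
      unfolding weight_def using joined_in[OF V] by (intro prod.cong) auto
    finally show ?thesis .
  qed
  have ev_split: "diag_even fl D V \<longleftrightarrow> diag_even fl (D - D') V0 \<and> diag_even fl D' (restrict V D')"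
    if V: "V \<in> ?S" for V
  proof -
    have "V (i, i) = V0 (i, i)" if "(i, i) \<in> D - D'" for i using S(4)[OF V] that by blast
    moreover have "(i, i) \<in> D \<longleftrightarrow> (i, i) \<in> D - D' \<or> (i, i) \<in> D'" for i using D'D by blast
    ultimately show ?thesis
      unfolding diag_even_def by (metis restrict_apply')
  qed
  have restr: "restrict V D' \<in> fillings D' M" if V: "V \<in> ?S" for V
    using S(1,3)[OF V] subsetD[OF D'D] unfolding fillings_iff by (auto simp: PiE_iff)
  have "(\<Sum>V\<in>?S. weight X b D V * of_bool (diag_even fl D V)) =
      (\<Sum>W\<in>fillings D' M. ?out * ?ev * (weight X b D' W * of_bool (diag_even fl D' W)))"
  proof (rule sum.reindex_bij_witness[of _ ?m "\<lambda>V. restrict V D'"], goal_cases)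
    case (1 V)
    have "?m (restrict V D') p = V p" for p
      using S(4)[OF 1, of p] PiE_arb[OF S(2)[OF 1], of p] PiE_arb[OF V0L, of p]
      by (cases "p \<in> D'"; cases "p \<in> D") auto
    then show ?case by blast
  next
    case (3 W)
    then have "W \<in> extensional D'" by (simp add: fillings_def PiE_iff)
    then show ?case by (auto simp: fun_eq_iff extensional_def)
  next
    case (5 V)
    then show ?case unfolding weight_split[OF 5] ev_split[OF 5] of_bool_conj by (simp add: mult_ac)
  qed (use merge restr in auto)
  then show ?thesis
    unfolding filling_sum_def sum_distrib_left .
qed

section \<open>Symmetry in finitely many variables\<close>

text \<open>Forgets the prime: \<open>i'\<close> and \<open>i\<close> both have index
  \<open>i\<close>.\<close>

definition pair_index :: "nat \<Rightarrow> nat" where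
  "pair_index v = (v + 1) div 2"

definition variable_sum ::
  "nat \<Rightarrow> bool \<Rightarrow> (nat \<times> nat) set \<Rightarrow> 'a::comm_ring_1 \<Rightarrow> (nat \<Rightarrow> 'a) \<Rightarrow> 'a" where
  "variable_sum N fl D b x =
     filling_sum (\<lambda>v. x (pair_index v)) b {1..2 * N} D (\<lambda>V. of_bool (diag_even fl D V))"

text \<open>On each fibre of \<open>outer_key\<close> the outer factor does not involve the two
  exchanged variables, and the inner factor is a four-letter sum to which
  \<open>two_letter_symmetry\<close> applies.\<close>

lemma variable_sum_adjacent:
  fixes x :: "nat \<Rightarrow> 'a::comm_ring_1"
  assumes D: "finite D" "shifted_convex D" and m: "Suc (Suc m) \<le> N"
  shows "variable_sum N fl D b (x \<circ> Transposition.transpose (Suc m) (Suc (Suc m))) = variable_sum N fl D b x"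
proof -
  define y where "y = x \<circ> Transposition.transpose (Suc m) (Suc (Suc m))"
  define M where "M = four_letters (2 * m)"
  let ?L = "{1..2 * N}" and ?k = "outer_key M D"
  let ?X = "\<lambda>x :: nat \<Rightarrow> 'a. \<lambda>v. x (pair_index v)"
  let ?g = "\<lambda>x V. weight (?X x) b D V * of_bool (diag_even fl D V)"
  have LM: "four_letters (2 * m) \<subseteq> ?L" "0 \<notin> ?L" using m by (auto simp: four_letters_def)
  have fin: "finite (fillings D ?L)" using D(1) by (simp add: finite_fillings)
  have "(\<Sum>V\<in>{V \<in> fillings D ?L. ?k V = U}. ?g y V) = (\<Sum>V\<in>{V \<in> fillings D ?L. ?k V = U}. ?g x V)"
    if U: "U \<in> ?k ` fillings D ?L" for U
  proof -
    obtain V0 where V0: "V0 \<in> fillings D ?L" "U = ?k V0" using U by blast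
    define D' where "D' = {p \<in> D. V0 p \<in> M}"
    note fib = fiber_filling_sum[OF D(1) LM V0(1), of _ b fl, folded M_def, folded V0(2) D'_def]
    have "y (pair_index v) = x (pair_index v)" if "v \<notin> M" for v
    proof -
      have "pair_index v \<noteq> Suc m" "pair_index v \<noteq> Suc (Suc m)"
        using that unfolding M_def four_letters_def pair_index_def by auto
      then show ?thesis by (simp add: y_def Transposition.transpose_def)
    qed
    then have out: "(\<Prod>p\<in>D - D'. ?X y (V0 p) - (if joined D V0 p then b else 0)) =
        (\<Prod>p\<in>D - D'. ?X x (V0 p) - (if joined D V0 p then b else 0))"
      by (intro prod.cong) (auto simp: D'_def)
    have tw: "filling_sum (?X z) b M D' \<phi> =
        filling_sum (two_weights (2 * m) (z (Suc m)) (z (Suc (Suc m)))) b M D' \<phi>" for z \<phi>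
      by (rule filling_sum_weight_cong)
        (auto simp: M_def four_letters_def pair_index_def two_weights_def)
    have "shifted_convex D'" "finite D'"
      unfolding D'_def M_def using shifted_convex_letters[OF D(2) V0(1)] D(1) by simp_all
    then have "filling_sum (?X y) b M D' (\<lambda>V. of_bool (diag_even fl D' V)) =
        filling_sum (?X x) b M D' (\<lambda>V. of_bool (diag_even fl D' V))"
      unfolding tw unfolding M_def
      by (subst two_letter_symmetry) (simp_all add: y_def)
    then show ?thesis unfolding fib out by simp
  qed
  then show ?thesis
    unfolding y_def[symmetric] variable_sum_def filling_sum_def
    by (subst (1 2) sum.image_gen[OF fin, of _ ?k]) (rule sum.cong, auto)
qed

lemma variable_sum_transpose:
  assumes D: "finite D" "shifted_convex D" and "a < c" "1 \<le> a" "c \<le> N"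
  shows "variable_sum N fl D b (x \<circ> Transposition.transpose a c) = variable_sum N fl D b x"
proof -
  have "Suc a \<le> c" using assms(3) by simp
  then show ?thesis using \<open>c \<le> N\<close>
  proof (induction c arbitrary: x rule: dec_induct)
    case (base x)
    obtain m where m: "a = Suc m" using assms(4) by (cases a) auto
    show ?case unfolding m by (rule variable_sum_adjacent[OF D]) (use base m in simp)
  next
    case (step c x)
    obtain m where m: "c = Suc m" using step.hyps by (cases c) auto
    \<comment> \<open>Conjugation by an adjacent transposition reduces the distance between the
      exchanged indices.\<close>
    have "Transposition.transpose a (Suc c) =
        Transposition.transpose c (Suc c) \<circ> Transposition.transpose a c \<circ> Transposition.transpose c (Suc c)"
      using step.hyps by (auto simp: fun_eq_iff Transposition.transpose_def)
    then have "x \<circ> Transposition.transpose a (Suc c) =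
        ((x \<circ> Transposition.transpose c (Suc c)) \<circ> Transposition.transpose a c) \<circ> Transposition.transpose c (Suc c)"
      by (simp only: comp_assoc)
    moreover have "variable_sum N fl D b (z \<circ> Transposition.transpose c (Suc c)) = variable_sum N fl D b z" for z
      unfolding m by (rule variable_sum_adjacent[OF D]) (use step.prems m in simp)
    moreover have "variable_sum N fl D b (z \<circ> Transposition.transpose a c) = variable_sum N fl D b z" for z
      by (rule step.IH) (use step.prems in simp)
    ultimately show ?case by (simp only:)
  qed
qed

lemma variable_sum_permutes:
  assumes D: "finite D" "shifted_convex D" and \<sigma>: "\<sigma> permutes {1..N}"
  shows "variable_sum N fl D b (x \<circ> \<sigma>) = variable_sum N fl D b x"
proof -
  have tr: "variable_sum N fl D b (x \<circ> Transposition.transpose a c) = variable_sum N fl D b x"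
    if "a \<in> {1..N}" "c \<in> {1..N}" for a c x
    using that variable_sum_transpose[OF D, of a c N fl b x] variable_sum_transpose[OF D, of c a N fl b x]
    by (cases a c rule: linorder_cases) (auto simp: transpose_commute)
  show ?thesis
    using \<sigma> finite_atLeastAtMost[of 1 N]
  proof (induction arbitrary: x rule: permutes_induct)
    case (swap a c p x)
    then show ?case using tr[of a c x] by (simp only: comp_assoc[symmetric])
  qed simp
qed

section \<open>Bars\<close>

definition is_bar :: "(nat \<times> nat \<Rightarrow> nat) \<Rightarrow> (nat \<times> nat) set \<Rightarrow> bool" where
  "is_bar V B \<longleftrightarrow> contiguous_line B \<and> (\<forall>b\<in>B. \<forall>c\<in>B. V b = V c)"

lemma is_barD:
  "is_bar V B \<Longrightarrow> contiguous_line B"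
  "is_bar V B \<Longrightarrow> b \<in> B \<Longrightarrow> c \<in> B \<Longrightarrow> V b = V c"
  unfolding is_bar_def by blast+

definition bar_partitions :: "(nat \<times> nat) set \<Rightarrow> (nat \<times> nat \<Rightarrow> nat) \<Rightarrow> (nat \<times> nat) set set set" where
  "bar_partitions D V = {P. partition_on D P \<and> (\<forall>B\<in>P. is_bar V B)}"

text \<open>Ensures that a bar with several boxes is horizontal if its entry is even and vertical if
  it is odd.\<close>

definition no_repeats :: "(nat \<times> nat) set \<Rightarrow> (nat \<times> nat \<Rightarrow> nat) \<Rightarrow> bool" where
  "no_repeats D V \<longleftrightarrow>
     (\<forall>i k j. (i, j) \<in> D \<longrightarrow> (k, j) \<in> D \<longrightarrow> i \<noteq> k \<longrightarrow> even (V (i, j)) \<longrightarrow> V (i, j) \<noteq> V (k, j)) \<and>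
     (\<forall>i j k. (i, j) \<in> D \<longrightarrow> (i, k) \<in> D \<longrightarrow> j \<noteq> k \<longrightarrow> odd (V (i, j)) \<longrightarrow> V (i, j) \<noteq> V (i, k))"

lemma no_repeats_colD:
  "no_repeats D V \<Longrightarrow> (i, j) \<in> D \<Longrightarrow> (k, j) \<in> D \<Longrightarrow> V (i, j) = V (k, j) \<Longrightarrow> even (V (i, j)) \<Longrightarrow> i = k"
  unfolding no_repeats_def by blast

lemma no_repeats_rowD:
  "no_repeats D V \<Longrightarrow> (i, j) \<in> D \<Longrightarrow> (i, k) \<in> D \<Longrightarrow> V (i, j) = V (i, k) \<Longrightarrow> odd (V (i, j)) \<Longrightarrow> j = k"
  unfolding no_repeats_def by blast

definition bar_entry :: "(nat \<times> nat \<Rightarrow> nat) \<Rightarrow> (nat \<times> nat) set \<Rightarrow> nat" where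
  "bar_entry V B = V (SOME p. p \<in> B)"

text \<open>Each box of a bar beyond the first costs \<open>- b\<close>, so over a partition the
  exponents add up to the number of boxes minus the number of bars.\<close>

definition bar_weight :: "(nat \<Rightarrow> 'a::comm_ring_1) \<Rightarrow> 'a \<Rightarrow> (nat \<times> nat \<Rightarrow> nat) \<Rightarrow> (nat \<times> nat) set \<Rightarrow> 'a" where
  "bar_weight X b V B = X (bar_entry V B) * (- b) ^ (card B - 1)"

lemma bar_entry_eq: "p \<in> B \<Longrightarrow> (\<And>q. q \<in> B \<Longrightarrow> V q = V p) \<Longrightarrow> bar_entry V B = V p"
  unfolding bar_entry_def by (metis someI)

text \<open>For an odd entry in row \<open>0\<close> the truncated subtraction returns \<open>p\<close> itself.\<close>

definition bar_neighbour :: "(nat \<times> nat \<Rightarrow> nat) \<Rightarrow> nat \<times> nat \<Rightarrow> nat \<times> nat" where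
  "bar_neighbour V p = (if even (V p) then (fst p, Suc (snd p)) else (fst p - 1, snd p))"

lemma joined_iff:
  "joined E V p \<longleftrightarrow> bar_neighbour V p \<in> E \<and> V (bar_neighbour V p) = V p \<and> (odd (V p) \<longrightarrow> 0 < fst p)"
  by (cases p) (auto simp: joined_def bar_neighbour_def right_entry_eq_Some upper_entry_eq_Some
      gr0_conv_Suc)

lemma finite_bar_partitions: "finite D \<Longrightarrow> finite (bar_partitions D V)"
  unfolding bar_partitions_def
  by (rule finite_subset[OF _ finitely_many_partition_on[of D]]) auto

lemma contiguous_line_cases:
  assumes "contiguous_line B" "(i, j) \<in> B"
  obtains a c where "B = {i} \<times> {a..c}" "a \<le> j" "j \<le> c" | a c where "B = {a..c} \<times> {j}" "a \<le> i" "i \<le> c"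
  using assms unfolding contiguous_line_def by auto

text \<open>
  A box \<open>p\<close> of minimal content can only be the left or the bottom end of a bar, so it either
  forms a bar of its own or extends the bar of its neighbour.
\<close>

lemma bar_extend:
  assumes p: "p \<notin> E" and nr: "no_repeats (insert p E) V"
    and j: "joined E V p" and B: "B \<subseteq> E" "contiguous_line B" "bar_neighbour V p \<in> B"
    and const: "\<And>q r. q \<in> B \<Longrightarrow> r \<in> B \<Longrightarrow> V q = V r"
  shows "contiguous_line (insert p B)"
proof -
  obtain i k where pik: "p = (i, k)" by (cases p)
  have Vn: "V (bar_neighbour V p) = V p" using j by (simp add: joined_iff)
  have VB: "V q = V p" if "q \<in> B" for q using const[OF that B(3)] Vn by simp
  show ?thesis
  proof (cases "even (V p)")
    case True
    then have n: "bar_neighbour V p = (i, Suc k)" by (simp add: bar_neighbour_def pik)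
    have nB: "(i, Suc k) \<in> B" using B(3) n by simp
    \<comment> \<open>Reduces a vertical bar through the neighbour to a single box, which then
      counts as horizontal.\<close>
    have col: "i' = i" if "(i', Suc k) \<in> B" for i'
      by (rule no_repeats_colD[OF nr]) (use that nB B(1) VB[OF that] VB[OF nB] True in auto)
    obtain c where Bc: "B = {i} \<times> {Suc k..c}" "Suc k \<le> c"
    proof (rule contiguous_line_cases[OF B(2) nB])
      fix a c assume a: "B = {i} \<times> {a..c}" "a \<le> Suc k" "Suc k \<le> c"
      have "(i, k) \<notin> B" using p B(1) pik by auto
      then have "a = Suc k" using a by auto
      then show ?thesis using that a by blast
    next
      fix a c assume a: "B = {a..c} \<times> {Suc k}" "a \<le> i" "i \<le> c"
      have "a = i" "c = i" using col[of a] col[of c] a by auto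
      then have "B = {i} \<times> {Suc k..Suc k}" using a by auto
      then show ?thesis using that by blast
    qed
    have "insert p B = {i} \<times> {k..c}" using Bc by (auto simp: pik)
    then show ?thesis unfolding contiguous_line_def by blast
  next
    case False
    then obtain h where h: "i = Suc h" using j pik by (auto simp: joined_iff gr0_conv_Suc)
    then have n: "bar_neighbour V p = (h, k)" using False by (simp add: bar_neighbour_def pik)
    have nB: "(h, k) \<in> B" using B(3) n by simp
    have row: "k' = k" if "(h, k') \<in> B" for k'
      by (rule no_repeats_rowD[OF nr]) (use that nB B(1) VB[OF that] VB[OF nB] False in auto)
    obtain a where Ba: "B = {a..h} \<times> {k}" "a \<le> h"
    proof (rule contiguous_line_cases[OF B(2) nB])
      fix a c assume a: "B = {h} \<times> {a..c}" "a \<le> k" "k \<le> c"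
      have "a = k" "c = k" using row[of a] row[of c] a by auto
      then have "B = {h..h} \<times> {k}" using a by auto
      then show ?thesis using that by blast
    next
      fix a c assume a: "B = {a..c} \<times> {k}" "a \<le> h" "h \<le> c"
      have "(Suc h, k) \<notin> B" using p B(1) pik h by auto
      then have "c = h" using a by auto
      then show ?thesis using that a by blast
    qed
    have "insert p B = {a..i} \<times> {k}" using Ba by (auto simp: pik h)
    then show ?thesis unfolding contiguous_line_def by blast
  qed
qed

text \<open>Minimal content makes \<open>p\<close> an end of its bar, so cutting it off leaves an
  interval. The next box of the bar repeats the entry of \<open>p\<close>, and
  \<open>no_repeats\<close> then makes the parity match the direction, so that this box is
  \<open>bar_neighbour V p\<close>.\<close>

lemma bar_shrink:
  assumes nr: "no_repeats (insert p E) V"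
    and content: "\<And>q. q \<in> E \<Longrightarrow> fst q + snd p \<le> fst p + snd q"
    and B: "B \<subseteq> insert p E" "contiguous_line B" "p \<in> B" "B \<noteq> {p}"
    and const: "\<And>q r. q \<in> B \<Longrightarrow> r \<in> B \<Longrightarrow> V q = V r"
  shows "contiguous_line (B - {p})" "joined (insert p E) V p" "bar_neighbour V p \<in> B - {p}"
proof -
  obtain i k where pik: "p = (i, k)" by (cases p)
  have cont: "fst q + k \<le> i + snd q" if "q \<in> B" for q
    using content[of q] B(1) that pik by auto
  have "contiguous_line (B - {p}) \<and> joined (insert p E) V p \<and> bar_neighbour V p \<in> B - {p}"
  proof (rule contiguous_line_cases[OF B(2) B(3)[unfolded pik]])
    fix a c assume a: "B = {i} \<times> {a..c}" "a \<le> k" "k \<le> c"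
    \<comment> \<open>A box of the bar to the left of \<open>p\<close> would have smaller
      content.\<close>
    have ak: "a = k" using cont[of "(i, a)"] a by auto
    have kc: "k < c" using B(4) a ak pik by (cases "k = c") auto
    have n: "(i, Suc k) \<in> B" using a ak kc by auto
    then have Vn: "V (i, Suc k) = V p" using const B(3) by blast
    have ev: "even (V p)"
      using no_repeats_rowD[OF nr, of i k "Suc k"] subsetD[OF B(1) n] B(3) Vn unfolding pik by auto
    have "B - {p} = {i} \<times> {Suc k..c}" using a ak pik by auto
    then have "contiguous_line (B - {p})" unfolding contiguous_line_def by blast
    moreover have nb: "bar_neighbour V p = (i, Suc k)" using ev by (simp add: bar_neighbour_def pik)
    moreover have "joined (insert p E) V p"
      unfolding joined_iff nb using subsetD[OF B(1) n] Vn ev by simp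
    moreover have "(i, Suc k) \<noteq> p" using pik by simp
    ultimately show ?thesis using n by simp
  next
    fix a c assume a: "B = {a..c} \<times> {k}" "a \<le> i" "i \<le> c"
    have ic: "i = c" using cont[of "(c, k)"] a by auto
    have "a < i" using B(4) a ic pik by (cases "a = i") auto
    then obtain h where h: "i = Suc h" "a \<le> h" by (cases i) auto
    have n: "(h, k) \<in> B" using a ic h by auto
    then have Vn: "V (h, k) = V p" using const B(3) by blast
    have od: "odd (V p)"
      using no_repeats_colD[OF nr, of i k h] subsetD[OF B(1) n] B(3) Vn unfolding pik h by auto
    have "B - {p} = {a..h} \<times> {k}" using a ic pik h by auto
    then have "contiguous_line (B - {p})" unfolding contiguous_line_def by blast
    moreover have nb: "bar_neighbour V p = (h, k)" using od by (simp add: bar_neighbour_def pik h)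
    moreover have "joined (insert p E) V p"
      unfolding joined_iff nb using subsetD[OF B(1) n] Vn pik h by simp
    moreover have "(h, k) \<noteq> p" using pik h by simp
    ultimately show ?thesis using n by simp
  qed
  then show "contiguous_line (B - {p})" "joined (insert p E) V p" "bar_neighbour V p \<in> B - {p}"
    by blast+
qed

definition block_of :: "'a set set \<Rightarrow> 'a \<Rightarrow> 'a set" where
  "block_of P q = (THE B. B \<in> P \<and> q \<in> B)"

lemma block_of_eq:
  assumes "partition_on D P" "B \<in> P" "q \<in> B"
  shows "block_of P q = B"
  unfolding block_of_def
proof (rule the_equality)
  show "C = B" if "C \<in> P \<and> q \<in> C" for C
    using partition_onD2[OF assms(1)] that assms(2,3) by (auto simp: disjoint_def)
qed (use assms in simp)

lemma block_of_mem:
  assumes "partition_on D P" "q \<in> D"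
  shows "block_of P q \<in> P" "q \<in> block_of P q"
proof -
  obtain B where "B \<in> P" "q \<in> B" using assms partition_onD1 by blast
  then show "block_of P q \<in> P" "q \<in> block_of P q" using block_of_eq[OF assms(1)] by auto
qed

lemma partition_on_remove:
  assumes "partition_on D P" "B \<in> P"
  shows "partition_on (D - B) (P - {B})"
proof -
  have "B \<inter> \<Union> (P - {B}) = {}" using partition_onD2[OF assms(1)] assms(2) by (auto simp: disjoint_def)
  then have "disjnt B (\<Union> (P - {B}))" by (simp add: disjnt_def)
  then show ?thesis using partition_on_insert[of B "P - {B}" D] assms by (simp add: insert_absorb)
qed

lemma partition_on_add:
  assumes "partition_on (D - B) Q" "B \<subseteq> D" "B \<noteq> {}"
  shows "partition_on D (insert B Q)" "B \<notin> Q"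
proof -
  have "disjnt B (\<Union> Q)" using partition_onD1[OF assms(1)] by (auto simp: disjnt_def)
  then show "partition_on D (insert B Q)" using partition_on_insert[of B Q D] assms by simp
  show "B \<notin> Q" using partition_onD1[OF assms(1)] assms(3) by blast
qed

lemma joined_insert_self: "p \<notin> E \<Longrightarrow> joined (insert p E) V p \<longleftrightarrow> joined E V p"
  by (cases p) (auto simp: joined_iff bar_neighbour_def)

lemma bar_weight_insert:
  assumes "finite B" "p \<notin> B" "B \<noteq> {}" "\<And>q. q \<in> B \<Longrightarrow> V q = V p"
  shows "bar_weight X b V (insert p B) = - b * bar_weight X b V B"
proof -
  obtain q where q: "q \<in> B" using assms(3) by blast
  have "bar_entry V (insert p B) = V p" by (rule bar_entry_eq) (use assms(4) in auto)
  moreover have "bar_entry V B = V q" by (rule bar_entry_eq[OF q]) (use assms(4) q in auto)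
  moreover have "card (insert p B) - 1 = Suc (card B - 1)"
    using assms by (simp add: card_gt_0_iff)
  ultimately show ?thesis using assms(4)[OF q] by (simp add: bar_weight_def mult_ac)
qed

text \<open>Either \<open>{p}\<close> is a bar of its own, with factor \<open>X (V p)\<close>, or
  \<open>p\<close> lies in a longer bar. In the second case deleting \<open>p\<close> from its bar
  gives a bijection onto the bar partitions of \<open>E\<close>, at the price of a factor
  \<open>- b\<close>; this case is void unless \<open>p\<close> is joined.\<close>

lemma bar_partitions_insert_sum:
  fixes X :: "nat \<Rightarrow> 'a::comm_ring_1"
  assumes fin: "finite E" and p: "p \<notin> E" and nr: "no_repeats (insert p E) V"
    and content: "\<And>q. q \<in> E \<Longrightarrow> fst q + snd p \<le> fst p + snd q"
  shows "(\<Sum>P\<in>bar_partitions (insert p E) V. \<Prod>B\<in>P. bar_weight X b V B) =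
    (X (V p) - (if joined E V p then b else 0)) * (\<Sum>P\<in>bar_partitions E V. \<Prod>B\<in>P. bar_weight X b V B)"
proof -
  let ?D = "insert p E" and ?g = "\<lambda>P. \<Prod>B\<in>P. bar_weight X b V B" and ?n = "bar_neighbour V p"
  let ?A = "bar_partitions E V"
  let ?A1 = "{P \<in> bar_partitions ?D V. {p} \<in> P}" and ?A2 = "{P \<in> bar_partitions ?D V. {p} \<notin> P}"
  have "(\<Sum>P\<in>bar_partitions ?D V. ?g P) = sum ?g ?A1 + sum ?g ?A2"
    by (subst sum.union_disjoint[symmetric])
      (auto simp: finite_bar_partitions fin intro!: sum.cong)
  also have "sum ?g ?A1 = (\<Sum>P\<in>?A. X (V p) * ?g P)"
  proof (rule sum.reindex_bij_witness[of _ "insert {p}" "\<lambda>P. P - {{p}}"], goal_cases)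
    case (2 P)
    then have "partition_on (?D - {p}) (P - {{p}})"
      by (intro partition_on_remove) (auto simp: bar_partitions_def)
    moreover have "?D - {p} = E" using p by auto
    ultimately show ?case using 2 by (auto simp: bar_partitions_def)
  next
    case (3 P)
    then show ?case using partition_onD1[of E P] p by (auto simp: bar_partitions_def)
  next
    case (4 P)
    have "?D - {p} = E" using p by auto
    then have "partition_on ?D (insert {p} P)"
      using 4 by (intro partition_on_add) (auto simp: bar_partitions_def)
    moreover have "is_bar V {p}"
    proof -
      have "{p} = {fst p} \<times> {snd p..snd p}" by (cases p) auto
      then have "contiguous_line {p}" unfolding contiguous_line_def by blast
      then show ?thesis by (simp add: is_bar_def)
    qed
    ultimately show ?case using 4 by (simp add: bar_partitions_def)
  next
    case (5 P)
    then have "finite P" using finite_elements[of ?D P] fin by (auto simp: bar_partitions_def)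
    then have "?g P = bar_weight X b V {p} * ?g (P - {{p}})"
      using 5 by (intro prod.remove) auto
    then show ?case by (simp add: bar_weight_def bar_entry_def)
  qed auto
  also have "sum ?g ?A2 = (\<Sum>P\<in>?A. - (if joined E V p then b else 0) * ?g P)"
  proof (cases "joined E V p")
    case False
    have "P \<notin> ?A2" for P
    proof
      assume P: "P \<in> ?A2"
      then have part: "partition_on ?D P" by (simp add: bar_partitions_def)
      note bl = block_of_mem[OF part insertI1]
      have bar: "is_bar V (block_of P p)" and ne: "block_of P p \<noteq> {p}"
        using P bl(1) by (auto simp: bar_partitions_def)
      have "block_of P p \<subseteq> ?D" using bl(1) partition_onD1[OF part] by blast
      then have "joined ?D V p"
        using bar_shrink(2)[OF nr content _ is_barD(1)[OF bar] bl(2) ne is_barD(2)[OF bar]] by blast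
      then show False using False p by (simp add: joined_insert_self)
    qed
    then have "?A2 = {}" by blast
    then show ?thesis using False by (simp only: if_False sum.empty) simp
  next
    case True
    let ?f = "\<lambda>P. insert (insert p (block_of P ?n)) (P - {block_of P ?n})"
    let ?h = "\<lambda>P. insert (block_of P p - {p}) (P - {block_of P p})"
    have nE: "?n \<in> E" "V ?n = V p" using True by (simp_all add: joined_iff)
    have A: "partition_on E P" "block_of P ?n \<in> P" "?n \<in> block_of P ?n" "block_of P ?n \<subseteq> E"
      "p \<notin> block_of P ?n" "contiguous_line (insert p (block_of P ?n))"
      "\<And>q. q \<in> block_of P ?n \<Longrightarrow> V q = V p"
      "partition_on (E - block_of P ?n) (P - {block_of P ?n})"
      "partition_on ?D (?f P)" "insert p (block_of P ?n) \<notin> P - {block_of P ?n}"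
      if P: "P \<in> ?A" for P
    proof -
      show 1: "partition_on E P" using P by (simp add: bar_partitions_def)
      show 2: "block_of P ?n \<in> P" "?n \<in> block_of P ?n" using block_of_mem[OF 1 nE(1)] by auto
      show 3: "block_of P ?n \<subseteq> E" using 2 partition_onD1[OF 1] by blast
      then show "p \<notin> block_of P ?n" using p by blast
      have bar: "is_bar V (block_of P ?n)" using P 2(1) by (simp add: bar_partitions_def)
      note const = is_barD(2)[OF bar]
      show "contiguous_line (insert p (block_of P ?n))"
        by (rule bar_extend[OF p nr True 3 is_barD(1)[OF bar] 2(2) const])
      show "V q = V p" if "q \<in> block_of P ?n" for q
        using const[OF that 2(2)] nE(2) by simp
      show 4: "partition_on (E - block_of P ?n) (P - {block_of P ?n})"
        by (rule partition_on_remove[OF 1 2(1)])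
      have "?D - insert p (block_of P ?n) = E - block_of P ?n" using p by auto
      then have "partition_on (?D - insert p (block_of P ?n)) (P - {block_of P ?n})"
        using 4 by (simp only:)
      moreover have "insert p (block_of P ?n) \<subseteq> ?D" "insert p (block_of P ?n) \<noteq> {}" using 3 by blast+
      ultimately show "partition_on ?D (?f P)" "insert p (block_of P ?n) \<notin> P - {block_of P ?n}"
        by (rule partition_on_add)+
    qed
    have A2: "partition_on ?D P" "block_of P p \<in> P" "p \<in> block_of P p" "block_of P p \<subseteq> ?D"
      "contiguous_line (block_of P p - {p})" "?n \<in> block_of P p - {p}"
      "\<And>q. q \<in> block_of P p \<Longrightarrow> V q = V p"
      "partition_on E (?h P)" "block_of P p - {p} \<notin> P - {block_of P p}"
      if P: "P \<in> ?A2" for P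
    proof -
      show 1: "partition_on ?D P" using P by (simp add: bar_partitions_def)
      show 2: "block_of P p \<in> P" "p \<in> block_of P p" using block_of_mem[OF 1 insertI1] by auto
      show 3: "block_of P p \<subseteq> ?D" using 2 partition_onD1[OF 1] by blast
      have bar: "is_bar V (block_of P p)" and ne: "block_of P p \<noteq> {p}"
        using P 2(1) by (auto simp: bar_partitions_def)
      show "V q = V p" if "q \<in> block_of P p" for q using is_barD(2)[OF bar that 2(2)] .
      note sh = bar_shrink[OF nr content 3 is_barD(1)[OF bar] 2(2) ne is_barD(2)[OF bar]]
      show "contiguous_line (block_of P p - {p})" "?n \<in> block_of P p - {p}" using sh by auto
      have "E - (block_of P p - {p}) = ?D - block_of P p" using p 2(2) by auto
      then have "partition_on (E - (block_of P p - {p})) (P - {block_of P p})"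
        using partition_on_remove[OF 1 2(1)] by simp
      moreover have "block_of P p - {p} \<subseteq> E" "block_of P p - {p} \<noteq> {}" using 3 sh(3) by auto
      ultimately show "partition_on E (?h P)" "block_of P p - {p} \<notin> P - {block_of P p}"
        by (rule partition_on_add)+
    qed
    have "sum ?g ?A2 = (\<Sum>P\<in>?A. - b * ?g P)"
    proof (rule sum.reindex_bij_witness[of _ ?f ?h], goal_cases)
      case (1 P)
      have "block_of (?h P) ?n = block_of P p - {p}"
        by (rule block_of_eq[OF A2(8)[OF 1]]) (use A2(6)[OF 1] in auto)
      then show ?case
        by (simp only: Diff_insert_absorb[OF A2(9)[OF 1]] insert_Diff[OF A2(3)[OF 1]] insert_Diff[OF A2(2)[OF 1]])
    next
      case (2 P)
      have "is_bar V (block_of P p - {p})"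
        using A2(5,7)[OF 2] by (simp add: is_bar_def)
      then show ?case using A2(8)[OF 2] 2 by (simp add: bar_partitions_def)
    next
      case (3 P)
      have "block_of (?f P) p = insert p (block_of P ?n)"
        by (rule block_of_eq[OF A(9)[OF 3]]) auto
      then show ?case
        by (simp only: Diff_insert_absorb[OF A(10)[OF 3]] Diff_insert_absorb[OF A(5)[OF 3]] insert_Diff[OF A(2)[OF 3]])
    next
      case (4 P)
      \<comment> \<open>The enlarged bar also contains the neighbour, so it is not the singleton bar
        excluded from the second class.\<close>
      have "?n \<noteq> p" using nE(1) p by metis
      then have "{p} \<noteq> insert p (block_of P ?n)" using A(3)[OF 4] by blast
      moreover have "{p} \<notin> P" using partition_onD1[OF A(1)[OF 4]] p by blast
      ultimately have "{p} \<notin> ?f P" by blast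
      moreover have "is_bar V (insert p (block_of P ?n))"
        using A(6,7)[OF 4] by (simp add: is_bar_def)
      ultimately show ?case using A(9)[OF 4] 4 by (simp add: bar_partitions_def)
    next
      case (5 P)
      let ?B = "block_of P p"
      have finP: "finite P" using 5 finite_elements[of ?D P] fin by (auto simp: bar_partitions_def)
      have finB: "finite ?B" using A2(4)[OF 5] fin by (auto intro: finite_subset)
      have "?g P = bar_weight X b V ?B * ?g (P - {?B})"
        by (rule prod.remove[OF finP A2(2)[OF 5]])
      also have "bar_weight X b V ?B = - b * bar_weight X b V (?B - {p})"
      proof -
        have "bar_weight X b V (insert p (?B - {p})) = - b * bar_weight X b V (?B - {p})"
          by (rule bar_weight_insert) (use finB A2(6,7)[OF 5] in \<open>blast+\<close>)
        then show ?thesis by (simp only: insert_Diff[OF A2(3)[OF 5]])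
      qed
      also have "- b * bar_weight X b V (?B - {p}) * ?g (P - {?B}) = - b * ?g (?h P)"
        using finP A2(9)[OF 5] by (simp add: mult_ac)
      finally show ?case ..
    qed
    then show ?thesis using True by simp
  qed
  finally show ?thesis
    unfolding sum_distrib_left[symmetric] diff_conv_add_uminus distrib_right .
qed

lemma bar_partitions_sum:
  assumes "finite D" "no_repeats D V"
  shows "(\<Sum>P\<in>bar_partitions D V. \<Prod>B\<in>P. bar_weight X b V B) = weight X b D V"
  using assms
\<comment> \<open>The rank is the negative content, so boxes are inserted in order of decreasing
  content and each new one has minimal content.\<close>
proof (induction D rule: finite_ranking_induct[where f = "\<lambda>p. int (fst p) - int (snd p)"])
  case empty
  have "bar_partitions {} V = {{}}" by (auto simp: bar_partitions_def partition_on_def)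
  then show ?case by (simp add: weight_def)
next
  case (insert p E)
  show ?case
  proof (cases "p \<in> E")
    case True
    then show ?thesis using insert by (simp add: insert_absorb)
  next
    case False
    have content: "fst q + snd p \<le> fst p + snd q" if "q \<in> E" for q
      using insert.hyps(2)[OF that] by linarith
    have "no_repeats E V" using insert.prems unfolding no_repeats_def by blast
    moreover have "weight X b (insert p E) V = (X (V p) - (if joined E V p then b else 0)) * weight X b E V"
    proof -
      have "joined (insert p E) V q \<longleftrightarrow> joined E V q" if "q \<in> E" for q
        \<comment> \<open>Inserting the letter that \<open>V\<close> already has at \<open>p\<close>
          makes the function update trivial.\<close>
        using joined_insert[of p E q V "V p"] content that False by auto
      then show ?thesis
        unfolding weight_def using insert.hyps(1) False by (simp add: joined_insert_self)
    qed
    ultimately show ?thesis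
      using bar_partitions_insert_sum[OF insert.hyps(1) False insert.prems content, of X b] insert.IH by simp
  qed
qed

section \<open>Shifted bar tableaux of skew shape\<close>

lemma mem_SD_iff:
  "(r, s) \<in> SD lam \<longleftrightarrow> 1 \<le> r \<and> r \<le> length lam \<and> r \<le> s \<and> s < r + lam ! (r - 1)"
proof
  assume "1 \<le> r \<and> r \<le> length lam \<and> r \<le> s \<and> s < r + lam ! (r - 1)"
  then have "(r, s) = (r, r + (Suc s - r) - 1) \<and> 1 \<le> r \<and> r \<le> length lam \<and> 1 \<le> Suc s - r \<and>
      Suc s - r \<le> lam ! (r - 1)" by auto
  then show "(r, s) \<in> SD lam" unfolding SD_def by blast
qed (auto simp: SD_def)

lemma SD_order_ideal:
  assumes "strict_partition lam" "(k, l) \<in> SD lam" "1 \<le> r" "r \<le> k" "s \<le> l" "r \<le> s"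
  shows "(r, s) \<in> SD lam"
proof -
  have sorted: "sorted_wrt (>) lam" using assms(1) by (simp add: strict_partition_def)
  \<comment> \<open>Row \<open>a\<close> ends in column \<open>a + lam ! (a - 1) - 1\<close>.
    Strictness makes these ends weakly decrease from row to row in spite of the shift.\<close>
  have dec: "lam ! (b - 1) + (b - a) \<le> lam ! (a - 1)" if "1 \<le> a" "a \<le> b" "b \<le> length lam" for a b
    using that(2,1,3)
  proof (induction b rule: dec_induct)
    case (step n)
    have "lam ! n < lam ! (n - 1)"
      using sorted_wrt_nth_less[OF sorted, of "n - 1" n] step.hyps(1) step.prems by simp
    moreover have "lam ! (n - 1) + (n - a) \<le> lam ! (a - 1)"
      by (rule step.IH) (use step.prems in simp_all)
    moreover have "Suc n - a = Suc (n - a)" using step.hyps(1) by simp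
    ultimately show ?case by simp
  qed simp
  have kl: "k \<le> length lam" "l < k + lam ! (k - 1)" using assms(2) by (simp_all add: mem_SD_iff)
  have "lam ! (k - 1) + (k - r) \<le> lam ! (r - 1)" by (rule dec[OF assms(3,4) kl(1)])
  then have "s < r + lam ! (r - 1)" using kl(2) assms(4,5) by linarith
  then show ?thesis using assms(3,4,6) kl(1) by (simp add: mem_SD_iff)
qed

text \<open>A difference of two order ideals: \<open>SD lam\<close> is closed downwards, and a box
  of \<open>SD mu\<close> in the interval would pull the smaller end into
  \<open>SD mu\<close>.\<close>

lemma shifted_convex_skew_SD:
  assumes "strict_partition lam" "strict_partition mu"
  shows "shifted_convex (skew_SD lam mu)"
  unfolding shifted_convex_def
proof (intro conjI ballI allI impI)
  fix p assume "p \<in> skew_SD lam mu"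
  then show "fst p \<le> snd p" by (cases p) (simp add: skew_SD_def mem_SD_iff)
next
  fix i j k l r s
  assume *: "(i, j) \<in> skew_SD lam mu" "(k, l) \<in> skew_SD lam mu"
    "i \<le> r" "r \<le> k" "j \<le> s" "s \<le> l" "r \<le> s"
  have ij: "1 \<le> i" "i \<le> j" using *(1) by (auto simp: skew_SD_def mem_SD_iff)
  have "(r, s) \<in> SD lam"
    by (rule SD_order_ideal[OF assms(1), of k l]) (use * ij in \<open>auto simp: skew_SD_def\<close>)
  moreover have "(i, j) \<in> SD mu" if "(r, s) \<in> SD mu"
    by (rule SD_order_ideal[OF assms(2) that]) (use * ij in auto)
  ultimately show "(r, s) \<in> skew_SD lam mu" using *(1) by (auto simp: skew_SD_def)
qed

lemma entries_eq: "entries = {1..}"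
proof -
  have "v \<in> entries" if "1 \<le> v" for v
  proof (cases "even v")
    case True
    then have "v = unprimed (v div 2)" "1 \<le> v div 2" using that by (auto simp: unprimed_def elim!: evenE)
    then show ?thesis unfolding entries_def by blast
  next
    case False
    then have "v = primed ((v + 1) div 2)" "1 \<le> (v + 1) div 2" by (auto simp: primed_def elim!: oddE)
    then show ?thesis unfolding entries_def by blast
  qed
  then show ?thesis by (auto simp: entries_def primed_def unprimed_def)
qed

lemma is_primed_iff: "is_primed v \<longleftrightarrow> odd v"
proof
  assume "odd v"
  then have "v = primed ((v + 1) div 2)" "1 \<le> (v + 1) div 2" by (auto simp: primed_def elim!: oddE)
  then show "is_primed v" unfolding is_primed_def by blast
qed (auto simp: is_primed_def primed_def)

lemma is_unprimed_iff: "is_unprimed v \<longleftrightarrow> even v \<and> 1 \<le> v"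
proof
  assume "even v \<and> 1 \<le> v"
  then have "v = unprimed (v div 2)" "1 \<le> v div 2" by (auto simp: unprimed_def elim!: evenE)
  then show "is_unprimed v" unfolding is_unprimed_def by blast
qed (auto simp: is_unprimed_def unprimed_def)

text \<open>By monotonicity, equal entries in two boxes of a row or column force the same entry in
  the box next to the first, where the local rule forbids it for the parity in question.\<close>

lemma fillings_no_repeats:
  assumes D: "shifted_convex D" and V: "V \<in> fillings D L"
  shows "no_repeats D V"
proof -
  have col: False if "(i, j) \<in> D" "(k, j) \<in> D" "i < k" "even (V (i, j))" "V (i, j) = V (k, j)" for i k j
  proof -
    have "k \<le> j" using D that(2) by (auto simp: shifted_convex_def)
    then have s: "(Suc i, j) \<in> D"
      using shifted_convexD[OF D that(1,2), of "Suc i" j] that(3) by simp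
    have "V (Suc i, j) \<le> V (k, j)" using fillings_col_mono[OF D V s _ that(2)] that(3) by simp
    then show False
      using fillings_col_rel[OF V that(1) s] that(4,5) by (auto simp: col_rel_def)
  qed
  have row: False if "(i, j) \<in> D" "(i, k) \<in> D" "j < k" "odd (V (i, j))" "V (i, j) = V (i, k)" for i k j
  proof -
    have "i \<le> j" using D that(1) by (auto simp: shifted_convex_def)
    then have s: "(i, Suc j) \<in> D"
      using shifted_convexD[OF D that(1,2), of i "Suc j"] that(3) by simp
    have "V (i, Suc j) \<le> V (i, k)" using fillings_row_mono[OF D V s _ that(2)] that(3) by simp
    then show False
      using fillings_row_rel[OF V that(1) s] that(4,5) by (auto simp: row_rel_def)
  qed
  show ?thesis
    unfolding no_repeats_def
  proof (intro conjI allI impI notI)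
    fix i k j assume a: "(i, j) \<in> D" "(k, j) \<in> D" "i \<noteq> k" "even (V (i, j))" "V (i, j) = V (k, j)"
    show False
    proof (cases "i < k")
      case True
      show False by (rule col[OF a(1,2) True a(4,5)])
    next
      case False
      show False by (rule col[OF a(2,1)]) (use False a(3-5) in simp_all)
    qed
  next
    fix i j k assume a: "(i, j) \<in> D" "(i, k) \<in> D" "j \<noteq> k" "odd (V (i, j))" "V (i, j) = V (i, k)"
    show False
    proof (cases "j < k")
      case True
      show False by (rule row[OF a(1,2) True a(4,5)])
    next
      case False
      show False by (rule row[OF a(2,1)]) (use False a(3-5) in simp_all)
    qed
  qed
qed

definition ShBT :: "bool \<Rightarrow> nat list \<Rightarrow> nat list \<Rightarrow> bar_tableau set" where
  "ShBT fl lam mu = (if fl then ShBT_P lam mu else ShBT_Q lam mu)"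

text \<open>Tableaux constrain all pairs of boxes in a row or column, fillings only adjacent ones;
  convexity of the shape closes the gap.\<close>

lemma ShBT_iff:
  assumes "strict_partition lam" "strict_partition mu" "part_contained mu lam"
  shows "(V, P) \<in> ShBT fl lam mu \<longleftrightarrow> V \<in> fillings (skew_SD lam mu) {1..} \<and>
    diag_even fl (skew_SD lam mu) V \<and> P \<in> bar_partitions (skew_SD lam mu) V"
proof -
  let ?D = "skew_SD lam mu"
  have D: "shifted_convex ?D" by (rule shifted_convex_skew_SD[OF assms(1,2)])
  have Q: "(V, P) \<in> ShBT_Q lam mu \<longleftrightarrow> V \<in> fillings ?D {1..} \<and> P \<in> bar_partitions ?D V"
  proof
    assume "(V, P) \<in> ShBT_Q lam mu"
    then have T: "(V, P) \<in> shifted_bar_tableaux ?D" "semistandard ?D (V, P)"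
      using assms(3) by (auto simp: ShBT_Q_def)
    note T1 = T(1)[unfolded shifted_bar_tableaux_def mem_Collect_eq case_prod_conv entries_eq]
    have VE: "V \<in> ?D \<rightarrow>\<^sub>E {1..}" by (rule T1[THEN conjunct1])
    note rep = T1[THEN conjunct2, THEN conjunct1, rule_format]
    note rep' = T1[THEN conjunct2, THEN conjunct2, THEN conjunct1, rule_format]
    note mono = T(2)[unfolded semistandard_def fst_conv]
    have "row_rel (V (i, j)) (V (i, Suc j))" if "(i, j) \<in> ?D" "(i, Suc j) \<in> ?D" for i j
    proof -
      have "V (i, j) \<le> V (i, Suc j)"
        by (rule mono[THEN conjunct1, rule_format]) (use that in auto)
      moreover have "odd (V (i, j)) \<longrightarrow> V (i, j) \<noteq> V (i, Suc j)"
        using rep'[OF that] by (simp add: is_primed_iff)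
      ultimately show ?thesis by (auto simp: row_rel_def)
    qed
    moreover have "col_rel (V (i, j)) (V (Suc i, j))" if "(i, j) \<in> ?D" "(Suc i, j) \<in> ?D" for i j
    proof -
      have "V (i, j) \<le> V (Suc i, j)"
        by (rule mono[THEN conjunct2, rule_format]) (use that in auto)
      \<comment> \<open>\<open>0\<close> is even without being an unprimed letter.\<close>
      moreover have "1 \<le> V (i, j)" using PiE_mem[OF VE that(1)] by simp
      then have "even (V (i, j)) \<longrightarrow> V (i, j) \<noteq> V (Suc i, j)"
        using rep[OF that] by (simp add: is_unprimed_iff)
      ultimately show ?thesis by (auto simp: col_rel_def)
    qed
    ultimately have "V \<in> fillings ?D {1..}" using VE unfolding fillings_iff by blast
    moreover have "P \<in> bar_partitions ?D V"
      using T1[THEN conjunct2, THEN conjunct2, THEN conjunct2]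
      unfolding bar_partitions_def is_bar_def by (rule CollectI)
    ultimately show "V \<in> fillings ?D {1..} \<and> P \<in> bar_partitions ?D V" by blast
  next
    assume *: "V \<in> fillings ?D {1..} \<and> P \<in> bar_partitions ?D V"
    then have V: "V \<in> fillings ?D {1..}" by blast
    have VE: "V \<in> ?D \<rightarrow>\<^sub>E entries" using V by (simp add: fillings_def entries_eq)
    have "semistandard ?D (V, P)"
      unfolding semistandard_def using fillings_mono[OF D V] by auto
    moreover have "(V, P) \<in> shifted_bar_tableaux ?D"
      unfolding shifted_bar_tableaux_def mem_Collect_eq case_prod_conv
    proof (intro conjI)
      show "partition_on ?D P" "\<forall>B\<in>P. contiguous_line B \<and> (\<forall>b\<in>B. \<forall>c\<in>B. V b = V c)"
        using * unfolding bar_partitions_def is_bar_def by blast+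
      note nr = fillings_no_repeats[OF D V]
      show "\<forall>i k j. (i, j) \<in> ?D \<longrightarrow> (k, j) \<in> ?D \<longrightarrow> i \<noteq> k \<longrightarrow> is_unprimed (V (i, j)) \<longrightarrow>
          V (i, j) \<noteq> V (k, j)"
        unfolding is_unprimed_iff using no_repeats_colD[OF nr] by blast
      show "\<forall>i j k. (i, j) \<in> ?D \<longrightarrow> (i, k) \<in> ?D \<longrightarrow> j \<noteq> k \<longrightarrow> is_primed (V (i, j)) \<longrightarrow>
          V (i, j) \<noteq> V (i, k)"
        unfolding is_primed_iff using no_repeats_rowD[OF nr] by blast
    qed (rule VE)
    ultimately show "(V, P) \<in> ShBT_Q lam mu" using assms(3) by (simp add: ShBT_Q_def)
  qed
  show ?thesis
    by (cases fl) (simp_all add: ShBT_def ShBT_P_def Q diag_even_def is_primed_iff conj_ac)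
qed

section \<open>Power series\<close>

text \<open>The ring is now specialised to polynomials in the \<open>x\<close> variables with
  coefficients in \<open>int poly\<close>, realised as finitely supported functions on exponent
  vectors.\<close>

abbreviation series_var :: "nat \<Rightarrow> (nat \<Rightarrow>\<^sub>0 nat) \<Rightarrow>\<^sub>0 int poly" where
  "series_var i \<equiv> Poly_Mapping.single (Poly_Mapping.single i 1) 1"

abbreviation series_beta :: "(nat \<Rightarrow>\<^sub>0 nat) \<Rightarrow>\<^sub>0 int poly" where
  "series_beta \<equiv> Poly_Mapping.single 0 beta"

definition bar_exponent ::
  "(nat \<Rightarrow> nat) \<Rightarrow> (nat \<times> nat \<Rightarrow> nat) \<Rightarrow> (nat \<times> nat) set set \<Rightarrow> nat \<Rightarrow>\<^sub>0 nat" where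
  "bar_exponent \<sigma> V P = (\<Sum>B\<in>P. Poly_Mapping.single (\<sigma> (pair_index (bar_entry V B))) 1)"

lemma series_beta_power: "(- series_beta) ^ n = Poly_Mapping.single 0 ((- beta) ^ n)"
  by (induction n) (simp_all add: single_uminus mult_single)

lemma prod_single:
  fixes c :: "'b \<Rightarrow> 'c::comm_semiring_1" and k :: "'b \<Rightarrow> 'a::comm_monoid_add"
  shows "(\<Prod>B\<in>P. Poly_Mapping.single (k B) (c B)) = Poly_Mapping.single (\<Sum>B\<in>P. k B) (\<Prod>B\<in>P. c B)"
  by (induction P rule: infinite_finite_induct) (simp_all add: mult_single)

lemma prod_bar_weight:
  assumes D: "finite D" and P: "partition_on D P"
  shows "(\<Prod>B\<in>P. bar_weight (\<lambda>v. series_var (\<sigma> (pair_index v))) series_beta V B) =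
    Poly_Mapping.single (bar_exponent \<sigma> V P) ((- beta) ^ (card D - card P))"
proof -
  have finB: "finite B" "B \<noteq> {}" if "B \<in> P" for B
    using that partition_onD1[OF P] partition_onD3[OF P] D by (auto intro: finite_subset)
  have "card D = (\<Sum>B\<in>P. card B)"
    by (rule product_partition[OF P]) (rule finB)
  also have "\<dots> = (\<Sum>B\<in>P. (card B - 1) + 1)"
    using finB by (intro sum.cong) (auto simp: Suc_le_eq card_gt_0_iff)
  also have "\<dots> = (\<Sum>B\<in>P. card B - 1) + card P"
    by (simp only: sum.distrib) simp
  finally have "(\<Sum>B\<in>P. card B - 1) = card D - card P" by simp
  moreover have "bar_weight (\<lambda>v. series_var (\<sigma> (pair_index v))) series_beta V B =
      Poly_Mapping.single (Poly_Mapping.single (\<sigma> (pair_index (bar_entry V B))) 1) ((- beta) ^ (card B - 1))" for B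
    unfolding bar_weight_def series_beta_power by (simp add: mult_single)
  ultimately show ?thesis
    by (simp add: prod_single bar_exponent_def power_sum[symmetric])
qed

lemma mem_letter_pair_iff: "1 \<le> v \<Longrightarrow> v \<in> {primed i, unprimed i} \<longleftrightarrow> pair_index v = i"
  by (cases i) (auto simp: primed_def unprimed_def pair_index_def)

lemma bar_count_eq:
  assumes "V \<in> D \<rightarrow>\<^sub>E {1..}" "P \<in> bar_partitions D V"
  shows "bar_count (V, P) i = card {B \<in> P. pair_index (bar_entry V B) = i}"
proof -
  have "(\<exists>b\<in>B. V b \<in> {primed i, unprimed i}) \<longleftrightarrow> pair_index (bar_entry V B) = i" if B: "B \<in> P" for B
  proof -
    have part: "partition_on D P" and bar: "is_bar V B"
      using assms(2) B by (simp_all add: bar_partitions_def)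
    obtain q where q: "q \<in> B" using partition_onD3[OF part] B by (metis ex_in_conv)
    have entry: "bar_entry V B = V b" if "b \<in> B" for b
      by (rule bar_entry_eq[OF that]) (rule is_barD(2)[OF bar _ that])
    have pos: "1 \<le> V b" if "b \<in> B" for b
    proof -
      have "b \<in> D" using partition_onD1[OF part] B that by blast
      then show ?thesis using PiE_mem[OF assms(1)] by simp
    qed
    show ?thesis using q entry mem_letter_pair_iff[OF pos] by (metis (no_types))
  qed
  then have "{B \<in> P. \<exists>b\<in>B. V b \<in> {primed i, unprimed i}} = {B \<in> P. pair_index (bar_entry V B) = i}"
    by blast
  then show ?thesis by (simp add: bar_count_def)
qed

text \<open>Substituting along \<open>\<sigma>\<close> moves the exponent at \<open>i\<close> to
  \<open>\<sigma> i\<close>, and \<open>map_key\<close> moves it back. By surjectivity equality need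
  only be tested at positions of the form \<open>\<sigma> i\<close>.\<close>

lemma bar_exponent_eq_iff:
  assumes "bij \<sigma>" and P: "finite P" and x: "Poly_Mapping.lookup w = (\<lambda>i. card {B \<in> P. pair_index (bar_entry V B) = i})"
  shows "bar_exponent \<sigma> V P = m \<longleftrightarrow> w = Poly_Mapping.map_key \<sigma> m"
proof -
  have inj: "inj \<sigma>" and surj: "surj \<sigma>" using assms(1) by (auto simp: bij_def)
  have look: "Poly_Mapping.lookup (bar_exponent \<sigma> V P) (\<sigma> i) = Poly_Mapping.lookup w i" for i
  proof -
    have "Poly_Mapping.lookup (bar_exponent \<sigma> V P) (\<sigma> i) =
        (\<Sum>B\<in>P. if pair_index (bar_entry V B) = i then 1 else 0)"
      unfolding bar_exponent_def lookup_sum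
      by (intro sum.cong refl) (simp add: lookup_single when_def inj_eq[OF inj])
    also have "\<dots> = card {B \<in> P. pair_index (bar_entry V B) = i}"
      using P by (simp add: sum.If_cases Int_def)
    finally show ?thesis by (simp add: x)
  qed
  have "bar_exponent \<sigma> V P = m \<longleftrightarrow>
      (\<forall>i. Poly_Mapping.lookup (bar_exponent \<sigma> V P) (\<sigma> i) = Poly_Mapping.lookup m (\<sigma> i))"
    by (metis poly_mapping_eqI surj surjD)
  also have "\<dots> \<longleftrightarrow> w = Poly_Mapping.map_key \<sigma> m"
    unfolding look by (auto simp: poly_mapping_eq_iff fun_eq_iff map_key.rep_eq[OF inj])
  finally show ?thesis .
qed

definition j_comb :: "bool \<Rightarrow> nat list \<Rightarrow> nat list \<Rightarrow> power_series" where
  "j_comb fl lam mu = (\<lambda>m. \<Sum>T\<in>{T \<in> ShBT fl lam mu. x_weight T = m}.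
     (- beta) ^ (skew_size lam mu - num_bars T))"

text \<open>Truncation loses nothing at such \<open>m\<close>: as \<open>\<sigma>\<close> preserves
  \<open>{1..N}\<close>, a tableau of weight \<open>map_key \<sigma> m\<close> only has indices up
  to \<open>N\<close>, hence letters up to \<open>2 * N\<close>.\<close>

lemma lookup_variable_sum:
  assumes lam: "strict_partition lam" "strict_partition mu" "part_contained mu lam"
    and \<sigma>: "\<sigma> permutes {1..N}" and m: "Poly_Mapping.keys m \<subseteq> {1..N}"
  shows "Poly_Mapping.lookup (variable_sum N fl (skew_SD lam mu) series_beta (series_var \<circ> \<sigma>)) m =
    j_comb fl lam mu (Poly_Mapping.map_key \<sigma> m)"
proof -
  let ?D = "skew_SD lam mu" and ?m = "Poly_Mapping.map_key \<sigma> m"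
  let ?F = "{V \<in> fillings ?D {1..2 * N}. diag_even fl ?D V}"
  let ?c = "\<lambda>P. (- beta) ^ (card ?D - card P)"
  have bij: "bij \<sigma>" using \<sigma> by (rule permutes_bij)
  have fin: "finite ?D" by (rule finite_skew_SD)
  have conv: "shifted_convex ?D" by (rule shifted_convex_skew_SD[OF lam(1,2)])
  have finF: "finite ?F" using finite_fillings[OF fin, of "{1..2 * N}"] by simp
  have finbp: "finite (bar_partitions ?D V)" for V by (rule finite_bar_partitions[OF fin])
  have "variable_sum N fl ?D series_beta (series_var \<circ> \<sigma>) =
      (\<Sum>V\<in>?F. weight (\<lambda>v. series_var (\<sigma> (pair_index v))) series_beta ?D V)"
    unfolding variable_sum_def filling_sum_def
    by (rule sum.mono_neutral_cong_right) (auto simp: finite_fillings fin)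
  also have "\<dots> = (\<Sum>V\<in>?F. \<Sum>P\<in>bar_partitions ?D V. Poly_Mapping.single (bar_exponent \<sigma> V P) (?c P))"
  proof (rule sum.cong[OF refl])
    fix V assume "V \<in> ?F"
    then have nr: "no_repeats ?D V" using fillings_no_repeats[OF conv] by blast
    show "weight (\<lambda>v. series_var (\<sigma> (pair_index v))) series_beta ?D V =
        (\<Sum>P\<in>bar_partitions ?D V. Poly_Mapping.single (bar_exponent \<sigma> V P) (?c P))"
      unfolding bar_partitions_sum[OF fin nr, symmetric]
      by (rule sum.cong[OF refl], rule prod_bar_weight[OF fin]) (simp add: bar_partitions_def)
  qed
  finally have "Poly_Mapping.lookup (variable_sum N fl ?D series_beta (series_var \<circ> \<sigma>)) m =
      (\<Sum>V\<in>?F. \<Sum>P\<in>bar_partitions ?D V. if bar_exponent \<sigma> V P = m then ?c P else 0)"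
    by (simp add: lookup_sum lookup_single when_def)
  also have "\<dots> = (\<Sum>(V, P)\<in>(SIGMA V:?F. bar_partitions ?D V). if bar_exponent \<sigma> V P = m then ?c P else 0)"
    by (rule sum.Sigma[OF finF]) (simp add: finbp)
  also have "\<dots> = (\<Sum>T\<in>{T \<in> ShBT fl lam mu. x_weight T = ?m}.
     (- beta) ^ (skew_size lam mu - num_bars T))"
  proof (rule sum.mono_neutral_cong_right)
    show "finite (SIGMA V:?F. bar_partitions ?D V)" using finF finbp by blast
    have weight_iff: "bar_exponent \<sigma> V P = m \<longleftrightarrow> x_weight (V, P) = ?m" if T: "(V, P) \<in> ShBT fl lam mu" for V P
    proof (rule bar_exponent_eq_iff[OF bij])
      have V: "V \<in> ?D \<rightarrow>\<^sub>E {1..}" and P: "P \<in> bar_partitions ?D V"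
        using T by (auto simp: ShBT_iff[OF lam] fillings_def)
      show "finite P" using P finite_elements[OF fin] by (auto simp: bar_partitions_def)
      have "(V, P) \<in> ShBT_Q lam mu" using T by (auto simp: ShBT_def ShBT_P_def split: if_splits)
      then show "Poly_Mapping.lookup (x_weight (V, P)) = (\<lambda>i. card {B \<in> P. pair_index (bar_entry V B) = i})"
        by (simp add: lookup_x_weight bar_count_eq[OF V P] fun_eq_iff)
    qed
    have sub: "(V, P) \<in> ShBT fl lam mu" if "V \<in> ?F" "P \<in> bar_partitions ?D V" for V P
    proof -
      have "fillings ?D {1..2 * N} \<subseteq> fillings ?D {1..}"
        unfolding fillings_def by (auto simp: PiE_iff)
      then show ?thesis using that unfolding ShBT_iff[OF lam] by blast
    qed
    show "{T \<in> ShBT fl lam mu. x_weight T = ?m} \<subseteq> (SIGMA V:?F. bar_partitions ?D V)"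
    proof
      fix T assume T: "T \<in> {T \<in> ShBT fl lam mu. x_weight T = ?m}"
      obtain V P where VP: "T = (V, P)" by (cases T)
      have V: "V \<in> fillings ?D {1..}" and ev: "diag_even fl ?D V" and P: "P \<in> bar_partitions ?D V"
        using T by (simp_all add: VP ShBT_iff[OF lam])
      have TQ: "T \<in> ShBT_Q lam mu" using T by (auto simp: ShBT_def ShBT_P_def split: if_splits)
      have "V p \<in> {1..2 * N}" if p: "p \<in> ?D" for p
      proof -
        have pos: "1 \<le> V p" using fillings_mem[OF V p] by simp
        let ?i = "pair_index (V p)"
        have "bar_count T ?i \<noteq> 0"
          unfolding bar_count_pos_iff[OF TQ] using p mem_letter_pair_iff[OF pos, of ?i] VP by auto
        then have "Poly_Mapping.lookup ?m ?i \<noteq> 0" using lookup_x_weight[OF TQ] T by auto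
        then have "\<sigma> ?i \<in> Poly_Mapping.keys m"
          by (simp add: map_key.rep_eq[OF bij_is_inj[OF bij]] in_keys_iff)
        then have "\<sigma> ?i \<in> {1..N}" using m by blast
        then have "?i \<in> {1..N}" using permutes_in_image[OF \<sigma>] by blast
        then show ?thesis using pos by (auto simp: pair_index_def)
      qed
      then have "V \<in> fillings ?D {1..2 * N}" using V unfolding fillings_def by (auto simp: PiE_iff)
      then show "T \<in> (SIGMA V:?F. bar_partitions ?D V)" using ev P VP by simp
    qed
    show "\<forall>T\<in>(SIGMA V:?F. bar_partitions ?D V) - {T \<in> ShBT fl lam mu. x_weight T = ?m}.
        (case T of (V, P) \<Rightarrow> if bar_exponent \<sigma> V P = m then ?c P else 0) = 0"
    proof
      fix T assume T: "T \<in> (SIGMA V:?F. bar_partitions ?D V) - {T \<in> ShBT fl lam mu. x_weight T = ?m}"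
      obtain V P where VP: "T = (V, P)" by (cases T)
      then have "(V, P) \<in> ShBT fl lam mu" using T sub by simp
      moreover from this have "x_weight (V, P) \<noteq> ?m" using T VP by blast
      ultimately show "(case T of (V, P) \<Rightarrow> if bar_exponent \<sigma> V P = m then ?c P else 0) = 0"
        using weight_iff VP by simp
    qed
    show "(case T of (V, P) \<Rightarrow> if bar_exponent \<sigma> V P = m then ?c P else 0) =
        (- beta) ^ (skew_size lam mu - num_bars T)"
      if "T \<in> {T \<in> ShBT fl lam mu. x_weight T = ?m}" for T
      using that weight_iff by (cases T) (simp add: card_skew_SD[OF lam(3)] num_bars_def)
  qed
  finally show ?thesis by (simp add: j_comb_def)
qed

section \<open>From finitely many variables to all of them\<close>

lemma j_comb_permutes:
  assumes lam: "strict_partition lam" "strict_partition mu"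
    and \<sigma>: "\<sigma> permutes {1..N}" and m: "Poly_Mapping.keys m \<subseteq> {1..N}"
  shows "j_comb fl lam mu (Poly_Mapping.map_key \<sigma> m) = j_comb fl lam mu m"
proof (cases "part_contained mu lam")
  case True
  have "variable_sum N fl (skew_SD lam mu) series_beta (series_var \<circ> \<sigma>) =
      variable_sum N fl (skew_SD lam mu) series_beta (series_var \<circ> id)"
    using variable_sum_permutes[OF finite_skew_SD shifted_convex_skew_SD[OF lam] \<sigma>] by simp
  then show ?thesis
    using lookup_variable_sum[OF lam True \<sigma> m, of fl] lookup_variable_sum[OF lam True permutes_id m, of fl]
    by (simp add: map_key_id[folded id_def])
next
  case False
  then show ?thesis by (simp add: j_comb_def ShBT_def ShBT_P_def ShBT_Q_def)
qed

text \<open>Only the values of \<open>\<pi>\<close> at the finitely many positions of the support matter.\<close>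

lemma permutes_finite_restriction:
  fixes m :: "nat \<Rightarrow>\<^sub>0 nat"
  assumes \<pi>: "\<pi> permutes {1..}" and m: "Poly_Mapping.lookup m 0 = 0"
  obtains N \<sigma> where "\<sigma> permutes {1..N}" "Poly_Mapping.keys m \<subseteq> {1..N}"
    "Poly_Mapping.map_key \<pi> m = Poly_Mapping.map_key \<sigma> m"
proof -
  let ?K = "Poly_Mapping.keys m"
  define A where "A = \<pi> -` ?K"
  have bij: "bij \<pi>" using \<pi> by (rule permutes_bij)
  have K0: "0 \<notin> ?K" using m by (simp add: in_keys_iff)
  have \<pi>A: "\<pi> ` A = ?K" unfolding A_def using bij by (simp add: bij_is_surj surj_image_vimage_eq)
  have inj: "inj_on \<pi> A" using bij by (meson bij_is_inj inj_on_subset subset_UNIV)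
  have finA: "finite A" using \<pi>A inj by (metis finite_imageD finite_keys)
  have A0: "0 \<notin> A" using K0 \<pi> by (auto simp: A_def permutes_def)
  define N where "N = Max (insert 0 (A \<union> ?K))"
  have "A \<union> ?K \<subseteq> {..N}" using finA by (auto simp: N_def)
  then have sub: "A \<subseteq> {1..N}" "?K \<subseteq> {1..N}" using A0 K0 by (force simp: Suc_le_eq intro: gr0I)+
  have "card A = card ?K" using card_image[OF inj] \<pi>A by simp
  \<comment> \<open>\<open>\<pi>\<close> need not preserve \<open>{1..N}\<close>. Outside
    \<open>A\<close> it is replaced by any bijection between the complements, which exists because
    they have the same size.\<close>
  then have "card ({1..N} - A) = card ({1..N} - ?K)"
    using sub finA by (simp add: card_Diff_subset)
  then obtain h where h: "bij_betw h ({1..N} - A) ({1..N} - ?K)"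
    using finite_same_card_bij by blast
  define \<sigma> where "\<sigma> i = (if i \<in> A then \<pi> i else if i \<in> {1..N} then h i else i)" for i
  have "bij_betw \<sigma> A ?K"
    using inj \<pi>A by (auto simp: bij_betw_def inj_on_def \<sigma>_def)
  moreover have "bij_betw \<sigma> ({1..N} - A) ({1..N} - ?K)"
    using h by (rule bij_betw_cong[THEN iffD1, rotated]) (simp add: \<sigma>_def)
  ultimately have "bij_betw \<sigma> (A \<union> ({1..N} - A)) (?K \<union> ({1..N} - ?K))"
    by (rule bij_betw_combine) blast
  then have "bij_betw \<sigma> {1..N} {1..N}" using sub by (simp add: Un_absorb1)
  then have perm: "\<sigma> permutes {1..N}"
    by (rule bij_imp_permutes) (use sub in \<open>auto simp: \<sigma>_def\<close>)
  have "Poly_Mapping.lookup m (\<pi> i) = Poly_Mapping.lookup m (\<sigma> i)" for i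
  proof (cases "i \<in> A")
    case False
    then have "\<pi> i \<notin> ?K" by (simp add: A_def)
    moreover have "\<sigma> i \<notin> ?K"
    proof (cases "i \<in> {1..N}")
      case True
      then show ?thesis using bij_betwE[OF h] False by (auto simp: \<sigma>_def)
    next
      case i: False
      then show ?thesis using False sub(2) by (auto simp: \<sigma>_def)
    qed
    ultimately show ?thesis by (simp add: in_keys_iff)
  qed (simp add: \<sigma>_def)
  then have "Poly_Mapping.map_key \<pi> m = Poly_Mapping.map_key \<sigma> m"
    by (intro poly_mapping_eqI)
      (simp add: map_key.rep_eq[OF bij_is_inj[OF bij]] map_key.rep_eq[OF permutes_inj[OF perm]])
  then show ?thesis using that perm sub(2) by blast
qed

lemma j_comb_eq_0:
  assumes "Poly_Mapping.lookup m 0 \<noteq> 0"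
  shows "j_comb fl lam mu m = 0"
proof -
  have "x_weight T \<noteq> m" if T: "T \<in> ShBT fl lam mu" for T
  proof
    assume m: "x_weight T = m"
    have TQ: "T \<in> ShBT_Q lam mu" using T by (auto simp: ShBT_def ShBT_P_def split: if_splits)
    then have "bar_count T 0 \<noteq> 0" using lookup_x_weight[OF TQ] m assms by simp
    then obtain p where "p \<in> skew_SD lam mu" "fst T p = 0"
      unfolding bar_count_pos_iff[OF TQ] by (auto simp: primed_def unprimed_def)
    then show False using PiE_mem[OF ShBT_QD(1)[OF TQ], of p] by (simp add: entries_eq)
  qed
  then show ?thesis by (auto simp: j_comb_def intro!: sum.neutral)
qed

lemma symmetric_j_comb:
  assumes "strict_partition lam" "strict_partition mu"
  shows "symmetric_series (j_comb fl lam mu)"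
  unfolding symmetric_series_def permute_vars_def
proof (intro allI impI ext)
  fix \<pi> :: "nat \<Rightarrow> nat" and m :: "nat \<Rightarrow>\<^sub>0 nat"
  assume \<pi>: "\<pi> permutes {1..}"
  show "j_comb fl lam mu (Poly_Mapping.map_key \<pi> m) = j_comb fl lam mu m"
  proof (cases "Poly_Mapping.lookup m 0 = 0")
    case True
    obtain N \<sigma> where "\<sigma> permutes {1..N}" "Poly_Mapping.keys m \<subseteq> {1..N}"
      "Poly_Mapping.map_key \<pi> m = Poly_Mapping.map_key \<sigma> m"
      by (rule permutes_finite_restriction[OF \<pi> True])
    then show ?thesis using j_comb_permutes[OF assms] by simp
  next
    case False
    have "\<pi> 0 = 0" using \<pi> by (simp add: permutes_def)
    then have "Poly_Mapping.lookup (Poly_Mapping.map_key \<pi> m) 0 \<noteq> 0"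
      using False by (simp add: map_key.rep_eq[OF permutes_inj[OF \<pi>]])
    then show ?thesis using False by (simp add: j_comb_eq_0)
  qed
qed

theorem theorem4p2:
  fixes lam mu :: "nat list"
  assumes "strict_partition lam" and "strict_partition mu"
  shows "symmetric_series (jp_comb lam mu) \<and> symmetric_series (jq_comb lam mu)"
proof -
  have "jp_comb lam mu = j_comb True lam mu" "jq_comb lam mu = j_comb False lam mu"
    by (simp_all add: jp_comb_def jq_comb_def j_comb_def ShBT_def)
  then show ?thesis using symmetric_j_comb[OF assms] by simp
qed

end
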